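(* Let $$\widetilde{p}_A(g_0,g_1,g_2,\dots):=g_0+\sum_\Gamma\frac{g_0^{\mathrm{tr}(\Gamma)}}{|\mathrm{Aut}(\Gamma)|}\prod_v g_{l(v)}^{|\mathrm{out}(v)|-1},$$ where $\Gamma$ runs over the minimal representatives of levelled oriented forests (with no strong vertices) on at least two leaves and $v$ over the non-leaf vertices of $\Gamma$, and let $$\widetilde{\widetilde{Q}}_B(g_1,g_2,\dots):=\sum_{\mathcal{T}}\frac{1}{|\mathrm{Aut}(\mathcal{T})|}\prod_{v\in\mathcal{T}_s}\left(\frac{g_{l(v)}}{2}\right)^{|\mathrm{wout}(v)|}\prod_{v\in\mathcal{T}_w}g_{l(v)}^{|\mathrm{out}(v)|-1},$$ where $\mathcal{T}$ runs over the minimal representatives of levelled oriented strong trees on $n\ge1$ leaves. For a series $F$ in the variables $g_0,g_1,g_2,\dots$, let $F[1]$ denote the series obtained by substituting $g_{i+1}$ for $g_i$ for every $i$; thus $\widetilde{p}_A(\frac{g_0}{2},g_1,g_2,\dots)[1]=\widetilde{p}_A(\frac{g_1}{2},g_2,g_3,\dots)$ and $\widetilde{\widetilde{Q}}_B[1]=\widetilde{\widetilde{Q}}_B(g_2,g_3,\dots)$. Then the following inductive formula holds: $$\widetilde{\widetilde{Q}}_B=\widetilde{p}_A\left(\tfrac{g_0}{2},g_1,g_2,\dots\right)[1]+\widetilde{\widetilde{Q}}_B[1]\left(1+\widetilde{p}_A\left(\tfrac{g_0}{2},g_1,g_2,\dots\right)[1]\right).$$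
   Context: **Forests.** A levelled oriented forest is a finite disjoint union of finite rooted trees (non-planar, leaves unlabelled), with edges directed away from the roots; the degenerate tree consisting of a single leaf is allowed as a component. Leaves are the vertices without outgoing edges. A non-leaf vertex $v$ has level $l(v)=1+$ (distance from $v$ to the root of its tree). $\mathrm{out}(v)$ is the set of outgoing edges of $v$; $\mathrm{tr}(\Gamma)$ is the number of trees of $\Gamma$ (including degenerate ones). The vertices may moreover be divided into strong and weak ones: leaves are weak, each level contains at most one strong vertex, and the parent of a strong vertex is strong (so the strong vertices, if any, form a directed chain starting at a root). A tree is strong if it has at least one strong vertex. For a strong tree $\mathcal{T}$, $\mathcal{T}_s$ is the set of strong vertices, $\mathcal{T}_w$ is the set of weak non-leaf vertices, and for a strong vertex $v$, $\mathrm{wout}(v)$ is the set of outgoing edges from $v$ to weak vertices (leaves included). $\mathrm{Aut}$ denotes the group of automorphisms as a rooted oriented forest, sending strong vertices to strong vertices and weak vertices to weak vertices. A trivial tail is a weak subtree (no strong vertices) with a single leaf stemming from a non-leaf vertex $v$, its root, with $|\mathrm{out}(v)|=1$. Two forests (or trees) are equivalent if they differ only by trivial tails (i.e. by replacing such subtrees with a single leaf, or conversely); the minimal representative of an equivalence class is the element in it with no trivial tails (equivalently, every weak non-leaf vertex has at least two leaves among its descendants; a strong vertex may have just one). All sums are over isomorphism classes, and the series are formal power series with rational coefficients in infinitely many variables (infinitely many monomials of a given degree may occur). *)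

theory Defs
  imports Complex_Main "HOL-Library.Multiset" "HOL-Combinatorics.Permutations"
begin

section \<open>Formal power series in the variables \<open>g\<^sub>0, g\<^sub>1, g\<^sub>2, \<dots>\<close>\<close>

text \<open>
  A monomial is the multiset of the indices of its variables, so that multiplying monomials is
  adding multisets. A series is an arbitrary family of rational coefficients: infinitely many
  monomials of the same degree may occur.
\<close>

typedef gseries = "UNIV :: (nat multiset \<Rightarrow> rat) set"
  morphisms coeff GSeries ..

setup_lifting type_definition_gseries

lemma gseries_eqI: "(\<And>m. coeff F m = coeff G m) \<Longrightarrow> F = G"
  by (simp add: coeff_inject[symmetric] fun_eq_iff)

lemma finite_mset_factorizations: "finite {(A, B). A + B = (m :: nat multiset)}"
proof (induction m)
  case empty
  have "{(A, B). A + B = ({#} :: nat multiset)} = {({#}, {#})}" by auto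
  then show ?case by simp
next
  case (add x m)
  let ?S = "{(A, B). A + B = m}"
  have "{(A, B). A + B = add_mset x m}
      \<subseteq> (\<lambda>(A, B). (add_mset x A, B)) ` ?S \<union> (\<lambda>(A, B). (A, add_mset x B)) ` ?S"
  proof clarify
    fix A B
    assume eq: "A + B = add_mset x m"
      and nin: "(A, B) \<notin> (\<lambda>(A, B). (A, add_mset x B)) ` ?S"
    have "x \<in># A \<or> x \<in># B"
      using eq by (metis union_iff union_single_eq_member add_mset_add_single)
    then show "(A, B) \<in> (\<lambda>(A, B). (add_mset x A, B)) ` ?S"
    proof
      assume "x \<in># A"
      then obtain A' where "A = add_mset x A'" by (metis insert_DiffM)
      with eq show ?thesis by (auto intro!: image_eqI[of _ _ "(A', B)"])
    next
      assume "x \<in># B"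
      then obtain B' where "B = add_mset x B'" by (metis insert_DiffM)
      with eq nin show ?thesis by (auto simp: image_iff)
    qed
  qed
  then show ?case by (rule finite_subset) (use add.IH in simp)
qed

instantiation gseries :: comm_ring_1
begin

lift_definition zero_gseries :: gseries is "\<lambda>m. 0" .

lift_definition one_gseries :: gseries is "\<lambda>m. if m = {#} then 1 else 0" .

lift_definition plus_gseries :: "gseries \<Rightarrow> gseries \<Rightarrow> gseries" is "\<lambda>F G m. F m + G m" .

lift_definition minus_gseries :: "gseries \<Rightarrow> gseries \<Rightarrow> gseries" is "\<lambda>F G m. F m - G m" .

lift_definition uminus_gseries :: "gseries \<Rightarrow> gseries" is "\<lambda>F m. - F m" .

lift_definition times_gseries :: "gseries \<Rightarrow> gseries \<Rightarrow> gseries"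
  is "\<lambda>F G m. \<Sum>(A, B) | A + B = m. F A * G B" .

instance
proof
  fix a b c :: gseries
  show "a + b + c = a + (b + c)" "a + b = b + a" "0 + a = a" "- a + a = 0" "a - b = a + - b"
    by (transfer, auto)+
  show "a * b * c = a * (b * c)"
  proof transfer
    fix a b c :: "nat multiset \<Rightarrow> rat"
    have "(\<Sum>(D, C) | D + C = m. (\<Sum>(A, B) | A + B = D. a A * b B) * c C) =
          (\<Sum>(A, D) | A + D = m. a A * (\<Sum>(B, C) | B + C = D. b B * c C))" for m
    proof -
      have "(\<Sum>(D, C) | D + C = m. (\<Sum>(A, B) | A + B = D. a A * b B) * c C) =
            (\<Sum>p | fst p + snd p = m. \<Sum>q | fst q + snd q = fst p. a (fst q) * b (snd q) * c (snd p))"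
        by (simp add: case_prod_unfold sum_distrib_right)
      also have "\<dots> = (\<Sum>(p, q) \<in> Sigma {p. fst p + snd p = m} (\<lambda>p. {q. fst q + snd q = fst p}).
                         a (fst q) * b (snd q) * c (snd p))"
        using finite_mset_factorizations
        by (subst sum.Sigma) (auto simp: case_prod_unfold)
      also have "\<dots> = (\<Sum>(p, q) \<in> Sigma {p. fst p + snd p = m} (\<lambda>p. {q. fst q + snd q = snd p}).
                         a (fst p) * (b (fst q) * c (snd q)))"
        by (rule sum.reindex_bij_witness
            [where i = "\<lambda>(p, q). ((fst p + fst q, snd q), (fst p, fst q))"
               and j = "\<lambda>(p, q). ((fst q, snd q + snd p), (snd q, snd p))"])
           (auto simp: add.assoc mult.assoc)
      also have "\<dots> = (\<Sum>p | fst p + snd p = m. \<Sum>q | fst q + snd q = snd p.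
                         a (fst p) * (b (fst q) * c (snd q)))"
        using finite_mset_factorizations
        by (subst sum.Sigma) (auto simp: case_prod_unfold)
      also have "\<dots> = (\<Sum>(A, D) | A + D = m. a A * (\<Sum>(B, C) | B + C = D. b B * c C))"
        by (simp add: case_prod_unfold sum_distrib_left)
      finally show ?thesis .
    qed
    then show "(\<lambda>m. \<Sum>(D, C) | D + C = m. (\<Sum>(A, B) | A + B = D. a A * b B) * c C) =
               (\<lambda>m. \<Sum>(A, D) | A + D = m. a A * (\<Sum>(B, C) | B + C = D. b B * c C))"
      by blast
  qed
  show "a * b = b * a"
  proof transfer
    fix a b :: "nat multiset \<Rightarrow> rat"
    have "(\<Sum>(A, B) | A + B = m. a A * b B) = (\<Sum>(A, B) | A + B = m. b A * a B)" for m
      by (rule sum.reindex_bij_witness[where i = prod.swap and j = prod.swap])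
         (auto simp: add.commute mult.commute)
    then show "(\<lambda>m. \<Sum>(A, B) | A + B = m. a A * b B) = (\<lambda>m. \<Sum>(A, B) | A + B = m. b A * a B)"
      by blast
  qed
  show "1 * a = a"
  proof transfer
    fix a :: "nat multiset \<Rightarrow> rat"
    have "(\<Sum>(A, B) | A + B = m. (if A = {#} then 1 else 0) * a B) = a m" for m
    proof -
      have "(\<Sum>(A, B) | A + B = m. (if A = {#} then 1 else 0) * a B) =
            (\<Sum>(A, B) \<in> {({#} :: nat multiset, m)}. (if A = {#} then 1 else 0) * a B)"
        by (rule sum.mono_neutral_right) (auto intro: finite_mset_factorizations split: if_splits)
      then show ?thesis by simp
    qed
    then show "(\<lambda>m. \<Sum>(A, B) | A + B = m. (if A = {#} then 1 else 0) * a B) = a"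
      by blast
  qed
  show "(a + b) * c = a * c + b * c"
    by transfer (auto simp: fun_eq_iff case_prod_unfold sum.distrib distrib_right)
  show "(0 :: gseries) \<noteq> 1"
    by transfer (auto simp: fun_eq_iff)
qed

end

lift_definition gconst :: "rat \<Rightarrow> gseries" is "\<lambda>c m. if m = {#} then c else 0" .

lift_definition gvar :: "nat \<Rightarrow> gseries" is "\<lambda>i m. if m = {#i#} then 1 else 0" .

text \<open>
  The sum of a locally finite family, i.e. one in which every monomial has a nonzero coefficient
  in finitely many members only. All families summed below are locally finite.
\<close>

definition formal_sum :: "'i set \<Rightarrow> ('i \<Rightarrow> gseries) \<Rightarrow> gseries" where
  "formal_sum I f = GSeries (\<lambda>m. \<Sum>i | i \<in> I \<and> coeff (f i) m \<noteq> 0. coeff (f i) m)"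

definition gsubst :: "(nat \<Rightarrow> gseries) \<Rightarrow> gseries \<Rightarrow> gseries" where
  "gsubst \<sigma> F = formal_sum UNIV (\<lambda>m. gconst (coeff F m) * (\<Prod>i\<in>#m. \<sigma> i))"

text \<open>\<open>F[1]\<close>: every \<open>g\<^sub>i\<close> is replaced by \<open>g\<^sub>i\<^sub>+\<^sub>1\<close>.\<close>

definition shift :: "gseries \<Rightarrow> gseries" where
  "shift F = gsubst (\<lambda>i. gvar (i + 1)) F"


section \<open>Levelled oriented forests\<close>

text \<open>An edge \<open>(u, v)\<close> leads from the parent \<open>u\<close> to its child \<open>v\<close>, away from the root.\<close>

record 'a forest =
  verts :: "'a set"
  edges :: "('a \<times> 'a) set"
  strong :: "'a set"

definition out :: "'a forest \<Rightarrow> 'a \<Rightarrow> ('a \<times> 'a) set" where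
  "out F v = {e \<in> edges F. fst e = v}"

definition leaves :: "'a forest \<Rightarrow> 'a set" where
  "leaves F = {v \<in> verts F. out F v = {}}"

definition roots :: "'a forest \<Rightarrow> 'a set" where
  "roots F = {v \<in> verts F. \<forall>u. (u, v) \<notin> edges F}"

definition tr :: "'a forest \<Rightarrow> nat" where
  "tr F = card (roots F)"

text \<open>In a forest, \<open>v\<close> is reachable from exactly one root, by exactly one directed path.\<close>

definition level :: "'a forest \<Rightarrow> 'a \<Rightarrow> nat" where
  "level F v = 1 + (LEAST n. \<exists>r\<in>roots F. (r, v) \<in> edges F ^^ n)"

text \<open>
  A finite directed graph is a disjoint union of rooted trees with edges directed away from the
  roots iff it has no directed cycle and every vertex has at most one parent.
\<close>

definition levelled_forest :: "'a forest \<Rightarrow> bool" where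
  "levelled_forest F \<longleftrightarrow>
     finite (verts F) \<and>
     edges F \<subseteq> verts F \<times> verts F \<and>
     acyclic (edges F) \<and>
     (\<forall>u u' v. (u, v) \<in> edges F \<and> (u', v) \<in> edges F \<longrightarrow> u = u') \<and>
     strong F \<subseteq> verts F \<and>
     strong F \<inter> leaves F = {} \<and>
     (\<forall>v\<in>strong F. \<forall>w\<in>strong F. level F v = level F w \<longrightarrow> v = w) \<and>
     (\<forall>u v. (u, v) \<in> edges F \<and> v \<in> strong F \<longrightarrow> u \<in> strong F)"

definition weak_nonleaves :: "'a forest \<Rightarrow> 'a set" where
  "weak_nonleaves F = verts F - leaves F - strong F"

definition wout :: "'a forest \<Rightarrow> 'a \<Rightarrow> ('a \<times> 'a) set" where
  "wout F v = {e \<in> out F v. snd e \<notin> strong F}"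

text \<open>The subtree stemming from \<open>v\<close> has vertex set \<open>(edges F)\<^sup>* `` {v}\<close>.\<close>

definition trivial_tail_at :: "'a forest \<Rightarrow> 'a \<Rightarrow> bool" where
  "trivial_tail_at F v \<longleftrightarrow>
     v \<in> verts F - leaves F \<and>
     card (out F v) = 1 \<and>
     (edges F)\<^sup>* `` {v} \<inter> strong F = {} \<and>
     card ((edges F)\<^sup>* `` {v} \<inter> leaves F) = 1"

definition minimal :: "'a forest \<Rightarrow> bool" where
  "minimal F \<longleftrightarrow> (\<forall>v. \<not> trivial_tail_at F v)"

definition forest_iso :: "('a \<Rightarrow> 'b) \<Rightarrow> 'a forest \<Rightarrow> 'b forest \<Rightarrow> bool" where
  "forest_iso f F G \<longleftrightarrow>
     bij_betw f (verts F) (verts G) \<and>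
     (\<forall>u\<in>verts F. \<forall>v\<in>verts F. (u, v) \<in> edges F \<longleftrightarrow> (f u, f v) \<in> edges G) \<and>
     (\<forall>v\<in>verts F. v \<in> strong F \<longleftrightarrow> f v \<in> strong G)"

text \<open>Automorphisms are extended by the identity outside \<open>verts F\<close>, so that each is counted once.\<close>

definition Aut :: "'a forest \<Rightarrow> ('a \<Rightarrow> 'a) set" where
  "Aut F = {f. f permutes verts F \<and> forest_iso f F F}"

text \<open>
  Up to isomorphism, every finite forest has its vertices in \<open>nat\<close>. The sum of \<open>t\<close> over the
  isomorphism classes of forests in \<open>A\<close> evaluates \<open>t\<close> at an arbitrary member of each class; it is
  meant for isomorphism-invariant \<open>A\<close> and \<open>t\<close>.
\<close>

definition iso_classes :: "nat forest set \<Rightarrow> nat forest set set" where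
  "iso_classes A = A // {(F, G). F \<in> A \<and> G \<in> A \<and> (\<exists>f. forest_iso f F G)}"

definition sum_up_to_iso :: "nat forest set \<Rightarrow> (nat forest \<Rightarrow> gseries) \<Rightarrow> gseries" where
  "sum_up_to_iso A t = formal_sum (iso_classes A) (\<lambda>C. t (SOME F. F \<in> C))"


section \<open>The two generating series\<close>

definition forests_A :: "nat forest set" where
  "forests_A = {F. levelled_forest F \<and> strong F = {} \<and> minimal F \<and> card (leaves F) \<ge> 2}"

definition trees_B :: "nat forest set" where
  "trees_B = {T. levelled_forest T \<and> tr T = 1 \<and> strong T \<noteq> {} \<and> minimal T \<and> card (leaves T) \<ge> 1}"

definition p_A :: gseries where
  "p_A = gvar 0 + sum_up_to_iso forests_A (\<lambda>F.
     gconst (1 / of_nat (card (Aut F))) * gvar 0 ^ tr F *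
     (\<Prod>v\<in>verts F - leaves F. gvar (level F v) ^ (card (out F v) - 1)))"

definition Q_B :: gseries where
  "Q_B = sum_up_to_iso trees_B (\<lambda>T.
     gconst (1 / of_nat (card (Aut T))) *
     (\<Prod>v\<in>strong T. (gconst (1 / 2) * gvar (level T v)) ^ card (wout T v)) *
     (\<Prod>v\<in>weak_nonleaves T. gvar (level T v) ^ (card (out T v) - 1)))"

text \<open>\<open>p_A\<close> with \<open>g\<^sub>0 / 2\<close> substituted for \<open>g\<^sub>0\<close>.\<close>

definition p_A_half :: gseries where
  "p_A_half = gsubst (\<lambda>i. if i = 0 then gconst (1 / 2) * gvar 0 else gvar i) p_A"

end

theory Submission
  imports Defs
begin

text \<open>
  Removing the root of a strong tree leaves at most one strong tree, since the strong vertices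
  have distinct levels, together with a forest of weak trees; conversely any such pair, not both
  parts empty, is grafted onto a new strong root. Grafting preserves minimality, raises all levels
  by one and multiplies the orders of the automorphism groups, and the root contributes
  \<open>(g\<^sub>1 / 2)\<^sup>k\<close> for \<open>k\<close> weak trees. Allowing also the empty forest (weight \<open>1\<close>) and the single leaf
  (weight \<open>g\<^sub>0\<close>), the weak parts sum to \<open>1 + p_A\<close> and the strong parts to \<open>1 + Q_B\<close>, so that
  \<open>1 + Q_B = (1 + Q_B[1]) (1 + p_A(g\<^sub>0 / 2, g\<^sub>1, \<dots>)[1])\<close>, where the empty pair accounts for the
  \<open>1\<close> on the left. All sums are locally finite because a monomial bounds the number of
  vertices on each level, and bounds the height, as the deepest non-leaf vertex has a positive
  exponent.
\<close>

subsection \<open>Sums of monomials\<close>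

text \<open>Every summand of either series is a rational number times one monomial, so a series is
  an index set carrying a coefficient and a monomial per index (\<open>mono_sum\<close>). Products
  become products of index sets, substitutions act index by index, and the formula becomes a
  matching of forests that respects both data. Two obstacles shape the rest. The sums run over
  isomorphism classes, while grafting acts on concrete forests: representatives are fixed once, and
  a pair of them is grafted after relabelling. And automorphism groups must split along grafting:
  the strong child of the root cannot be exchanged with a weak one, so isomorphisms of grafted trees
  preserve the strong and the weak part separately. The halves agree because each weak component
  contributes \<open>g_0 / 2\<close> to the substituted \<open>p_A\<close>, and the shift turns this
  into the factor \<open>g_1 / 2\<close> of the weak edge joining that component to the root. The
  term \<open>g_0\<close> accounts for all one-leaf weak forests, since minimality excludes every
  other one: a non-leaf vertex above a single leaf starts a trivial tail.\<close>

lift_definition gmon :: "rat \<Rightarrow> nat multiset \<Rightarrow> gseries" is "\<lambda>c m m'. if m' = m then c else 0" .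

text \<open>An infinite fibre of \<open>\<mu>\<close> yields coefficient 0, the default value of an
  infinite sum. Identities that split or multiply such sums therefore assume finite fibres.\<close>

lift_definition mono_sum :: "'i set \<Rightarrow> ('i \<Rightarrow> rat) \<Rightarrow> ('i \<Rightarrow> nat multiset) \<Rightarrow> gseries"
  is "\<lambda>I c \<mu> m. \<Sum>i | i \<in> I \<and> \<mu> i = m. c i" .

lemma coeff_GSeries [simp]: "coeff (GSeries f) = f"
  by (simp add: GSeries_inverse)

lemma gconst_eq_gmon: "gconst c = gmon c {#}"
  by transfer auto

lemma gvar_eq_gmon: "gvar i = gmon 1 {#i#}"
  by transfer auto

lemma one_eq_gmon: "1 = gmon 1 {#}"
  by transfer auto

lemma gmon_mult: "gmon c m * gmon d n = gmon (c * d) (m + n)"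
proof (rule gseries_eqI)
  fix k
  have "coeff (gmon c m * gmon d n) k =
      (\<Sum>p | fst p + snd p = k. if p = (m, n) then c * d else 0)"
    by (auto simp: times_gseries.rep_eq gmon.rep_eq case_prod_unfold intro!: sum.cong)
  also have "\<dots> = (if m + n = k then c * d else 0)"
    using finite_mset_factorizations[of k] by (simp add: sum.delta case_prod_unfold)
  finally show "coeff (gmon c m * gmon d n) k = coeff (gmon (c * d) (m + n)) k"
    by (auto simp: gmon.rep_eq)
qed

lemma gmon_prod:
  "finite A \<Longrightarrow> (\<Prod>i\<in>A. gmon (c i) (m i)) = gmon (\<Prod>i\<in>A. c i) (\<Sum>i\<in>A. m i)"
  by (induction rule: finite_induct) (auto simp: one_eq_gmon gmon_mult)

lemma gmon_prod_mset:
  "(\<Prod>i\<in>#m. gmon (c i) {#s i#}) = gmon (\<Prod>i\<in>#m. c i) (image_mset s m)"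
  by (induction m) (auto simp: one_eq_gmon gmon_mult)

text \<open>\<open>formal_sum\<close> ranges over the indices with nonzero coefficient at
  \<open>m\<close>, \<open>mono_sum\<close> over the whole fibre of \<open>m\<close>. With all
  \<open>c i\<close> nonzero these index sets coincide, so both sides also take the same default on
  infinite fibres.\<close>

lemma formal_sum_eq_mono_sum:
  assumes "\<And>i. i \<in> I \<Longrightarrow> f i = gmon (c i) (\<mu> i)" and "\<And>i. i \<in> I \<Longrightarrow> c i \<noteq> 0"
  shows "formal_sum I f = mono_sum I c \<mu>"
proof (rule gseries_eqI)
  fix m
  show "coeff (formal_sum I f) m = coeff (mono_sum I c \<mu>) m"
    by (auto simp: formal_sum_def mono_sum.rep_eq assms gmon.rep_eq intro!: sum.cong split: if_splits)
qed

lemma mono_sum_cong: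
  assumes "\<And>i. i \<in> I \<Longrightarrow> c i = d i" and "\<And>i. i \<in> I \<Longrightarrow> \<mu> i = \<nu> i"
  shows "mono_sum I c \<mu> = mono_sum I d \<nu>"
  by (rule gseries_eqI) (auto simp: mono_sum.rep_eq assms intro!: sum.cong)

lemma mono_sum_insert:
  fixes \<mu> :: "'i \<Rightarrow> nat multiset"
  assumes "\<And>m. finite {i \<in> I. \<mu> i = m}" and "x \<notin> I"
  shows "mono_sum (insert x I) c \<mu> = gmon (c x) (\<mu> x) + mono_sum I c \<mu>"
proof (rule gseries_eqI)
  fix m :: "nat multiset"
  have "{i. i \<in> insert x I \<and> \<mu> i = m} =
      (if \<mu> x = m then insert x {i \<in> I. \<mu> i = m} else {i \<in> I. \<mu> i = m})"
    by auto
  then show "coeff (mono_sum (insert x I) c \<mu>) m = coeff (gmon (c x) (\<mu> x) + mono_sum I c \<mu>) m"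
    using assms by (simp add: mono_sum.rep_eq plus_gseries.rep_eq gmon.rep_eq)
qed

text \<open>The pairs of total monomial \<open>m\<close> are grouped by the factorization of
  \<open>m\<close> that they induce. There are finitely many factorizations, and distinct ones give
  disjoint sets of pairs.\<close>

lemma mono_sum_mult:
  fixes \<mu> :: "'i \<Rightarrow> nat multiset" and \<nu> :: "'j \<Rightarrow> nat multiset"
  assumes fin: "\<And>m. finite {i \<in> I. \<mu> i = m}" "\<And>m. finite {j \<in> J. \<nu> j = m}"
  shows "mono_sum I c \<mu> * mono_sum J d \<nu> =
    mono_sum (I \<times> J) (\<lambda>p. c (fst p) * d (snd p)) (\<lambda>p. \<mu> (fst p) + \<nu> (snd p))"
proof (rule gseries_eqI)
  fix m
  let ?K = "{p :: nat multiset \<times> nat multiset. fst p + snd p = m}"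
  let ?X = "\<lambda>p. {i \<in> I. \<mu> i = fst p} \<times> {j \<in> J. \<nu> j = snd p}"
  have K: "finite ?K"
    using finite_mset_factorizations[of m] by (simp add: case_prod_unfold)
  have "coeff (mono_sum I c \<mu> * mono_sum J d \<nu>) m =
      (\<Sum>p\<in>?K. (\<Sum>i | i \<in> I \<and> \<mu> i = fst p. c i) * (\<Sum>j | j \<in> J \<and> \<nu> j = snd p. d j))"
    by (simp add: times_gseries.rep_eq mono_sum.rep_eq case_prod_unfold)
  also have "\<dots> = (\<Sum>p\<in>?K. \<Sum>q\<in>?X p. c (fst q) * d (snd q))"
    by (simp add: sum_product sum.cartesian_product case_prod_unfold)
  also have "\<dots> = (\<Sum>q\<in>(\<Union>p\<in>?K. ?X p). c (fst q) * d (snd q))"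
    by (rule sum.UNION_disjoint[symmetric]) (auto simp: K fin)
  also have "(\<Union>p\<in>?K. ?X p) = {q. q \<in> I \<times> J \<and> \<mu> (fst q) + \<nu> (snd q) = m}"
    by auto
  finally show "coeff (mono_sum I c \<mu> * mono_sum J d \<nu>) m =
      coeff (mono_sum (I \<times> J) (\<lambda>p. c (fst p) * d (snd p)) (\<lambda>p. \<mu> (fst p) + \<nu> (snd p))) m"
    by (simp add: mono_sum.rep_eq)
qed

text \<open>Since \<open>s\<close> is injective, distinct monomials keep distinct images. At most
  one monomial contributes to a coefficient of the result, so fibres are carried over intact. The
  shift is the case \<open>s = Suc\<close>, \<open>a = 1\<close>; the halving of \<open>g_0\<close>
  has \<open>s\<close> the identity.\<close>

lemma gsubst_mono_sum:
  assumes \<sigma>: "\<And>i. \<sigma> i = gmon (a i) {#s i#}" and "inj s"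
  shows "gsubst \<sigma> (mono_sum I c \<mu>) =
    mono_sum I (\<lambda>i. c i * (\<Prod>j\<in>#\<mu> i. a j)) (\<lambda>i. image_mset s (\<mu> i))"
proof (rule gseries_eqI)
  fix m'
  let ?F = "mono_sum I c \<mu>" and ?b = "\<lambda>m. \<Prod>j\<in>#m. a j"
  have inj: "image_mset s m = image_mset s n \<longleftrightarrow> m = n" for m n
    using multiset.inj_map[OF \<open>inj s\<close>] by (simp add: inj_eq)
  have "coeff (gsubst \<sigma> ?F) m' =
      (\<Sum>m | coeff (gmon (coeff ?F m * ?b m) (image_mset s m)) m' \<noteq> 0.
        coeff (gmon (coeff ?F m * ?b m) (image_mset s m)) m')"
    by (simp add: gsubst_def formal_sum_def \<sigma> gmon_prod_mset gconst_eq_gmon gmon_mult)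
  also have "\<dots> = (\<Sum>i | i \<in> I \<and> image_mset s (\<mu> i) = m'. c i * ?b (\<mu> i))"
  proof (cases "\<exists>m. image_mset s m = m'")
    case True
    then obtain m where m: "image_mset s m = m'" ..
    have "(\<Sum>k | coeff (gmon (coeff ?F k * ?b k) (image_mset s k)) m' \<noteq> 0.
        coeff (gmon (coeff ?F k * ?b k) (image_mset s k)) m') =
      (\<Sum>k\<in>{m}. coeff (gmon (coeff ?F k * ?b k) (image_mset s k)) m')"
      by (rule sum.mono_neutral_left) (auto simp: gmon.rep_eq m[symmetric] inj split: if_splits)
    also have "\<dots> = (\<Sum>i | i \<in> I \<and> \<mu> i = m. c i * ?b (\<mu> i))"
      by (auto simp: gmon.rep_eq m mono_sum.rep_eq sum_distrib_right intro!: sum.cong)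
    finally show ?thesis
      by (simp add: m[symmetric] inj)
  next
    case False
    then have "{i. i \<in> I \<and> image_mset s (\<mu> i) = m'} = {}"
      and "{m. coeff (gmon (coeff ?F m * ?b m) (image_mset s m)) m' \<noteq> 0} = {}"
      by (auto simp: gmon.rep_eq split: if_splits)
    then show ?thesis by (simp only: sum.empty)
  qed
  finally show "coeff (gsubst \<sigma> ?F) m' =
      coeff (mono_sum I (\<lambda>i. c i * ?b (\<mu> i)) (\<lambda>i. image_mset s (\<mu> i))) m'"
    by (simp add: mono_sum.rep_eq)
qed

subsection \<open>Isomorphisms\<close>

text \<open>\<open>forest_iso\<close> only compares pairs of vertices inside \<open>verts\<close>.
  It transports edges and strong labels only if these stay inside \<open>verts\<close>, which is
  what this predicate records.\<close>

definition wf_forest :: "'a forest \<Rightarrow> bool" where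
  "wf_forest F \<longleftrightarrow> finite (verts F) \<and> edges F \<subseteq> verts F \<times> verts F \<and> strong F \<subseteq> verts F"

lemma wf_forestD:
  assumes "wf_forest F"
  shows "finite (verts F)" "finite (edges F)" "finite (out F v)" "finite (strong F)"
    "(u, v) \<in> edges F \<Longrightarrow> u \<in> verts F" "(u, v) \<in> edges F \<Longrightarrow> v \<in> verts F"
    "v \<in> strong F \<Longrightarrow> v \<in> verts F"
proof -
  show "finite (edges F)"
    using assms unfolding wf_forest_def by (meson finite_SigmaI finite_subset)
  then show "finite (out F v)"
    unfolding out_def by simp
qed (use assms in \<open>auto simp: wf_forest_def intro: finite_subset\<close>)

lemma levelled_imp_wf: "levelled_forest F \<Longrightarrow> wf_forest F"
  by (auto simp: levelled_forest_def wf_forest_def)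

lemma forest_iso_id: "forest_iso (\<lambda>x. x) F F"
  by (simp add: forest_iso_def bij_betw_def)

lemma forest_iso_trans:
  assumes "forest_iso f F G" "forest_iso g G H"
  shows "forest_iso (g \<circ> f) F H"
proof -
  have "f v \<in> verts G" if "v \<in> verts F" for v
    using assms(1) that by (auto simp: forest_iso_def bij_betw_def)
  then show ?thesis
    using assms unfolding forest_iso_def by (auto intro: bij_betw_trans)
qed

lemma forest_iso_inv:
  assumes "forest_iso f F G"
  shows "forest_iso (inv_into (verts F) f) G F"
proof -
  let ?g = "inv_into (verts F) f"
  have bij: "bij_betw f (verts F) (verts G)"
    using assms by (simp add: forest_iso_def)
  have g: "?g v \<in> verts F" "f (?g v) = v" if "v \<in> verts G" for v
    using that bij by (auto simp: bij_betw_def inv_into_into f_inv_into_f)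
  show ?thesis
    unfolding forest_iso_def
    using assms g by (auto simp: forest_iso_def bij_betw_inv_into)
qed

lemma forest_iso_cong:
  "(\<And>v. v \<in> verts F \<Longrightarrow> f v = g v) \<Longrightarrow> forest_iso f F G \<longleftrightarrow> forest_iso g F G"
  unfolding forest_iso_def by (simp cong: bij_betw_cong)

locale iso =
  fixes f :: "'a \<Rightarrow> 'b" and F :: "'a forest" and G :: "'b forest"
  assumes iso: "forest_iso f F G" and wf: "wf_forest F" "wf_forest G"
begin

lemma inverse: "iso (inv_into (verts F) f) G F"
  using forest_iso_inv iso iso.intro wf by blast

lemma inj: "inj_on f (verts F)" and verts: "verts G = f ` verts F"
  using iso by (auto simp: forest_iso_def bij_betw_def)

lemma inj_iff: "u \<in> verts F \<Longrightarrow> v \<in> verts F \<Longrightarrow> f u = f v \<longleftrightarrow> u = v"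
  using inj by (meson inj_on_eq_iff)

lemma edge_iff: "u \<in> verts F \<Longrightarrow> v \<in> verts F \<Longrightarrow> (f u, f v) \<in> edges G \<longleftrightarrow> (u, v) \<in> edges F"
  and strong_iff: "v \<in> verts F \<Longrightarrow> f v \<in> strong G \<longleftrightarrow> v \<in> strong F"
  using iso by (auto simp: forest_iso_def)

lemma edge: "(u, v) \<in> edges F \<Longrightarrow> (f u, f v) \<in> edges G"
  using edge_iff wf_forestD[OF wf(1)] by blast

lemma strong: "strong G = f ` strong F"
  using wf verts strong_iff by (force simp: wf_forest_def)

lemma out: "v \<in> verts F \<Longrightarrow> out G (f v) = map_prod f f ` out F v"
  using wf_forestD(5,6)[OF wf(1)] wf_forestD(6)[OF wf(2)] edge
  by (force simp: out_def verts edge_iff)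

lemma inj_prod: "inj_on (map_prod f f) (out F v)"
  using wf_forestD(5,6)[OF wf(1)] by (auto intro!: inj_onI simp: out_def inj_iff)

lemma card_out: "v \<in> verts F \<Longrightarrow> card (out G (f v)) = card (out F v)"
  by (simp add: out card_image inj_prod)

lemma card_wout:
  assumes "v \<in> verts F"
  shows "card (wout G (f v)) = card (wout F v)"
proof -
  have *: "snd (map_prod f f e) \<in> strong G \<longleftrightarrow> snd e \<in> strong F" if "e \<in> out F v" for e
    using that wf_forestD(6)[OF wf(1)] by (cases e) (auto simp: out_def strong_iff)
  have filter: "{e \<in> g ` A. P e} = g ` {e \<in> A. Q e}" if "\<And>e. e \<in> A \<Longrightarrow> P (g e) \<longleftrightarrow> Q e"
    for g :: "'a \<times> 'a \<Rightarrow> 'b \<times> 'b" and A P Q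
    using that by auto
  have "wout G (f v) = map_prod f f ` wout F v"
    unfolding wout_def out[OF assms]
    by (rule filter[where P = "\<lambda>e. snd e \<notin> strong G" and Q = "\<lambda>e. snd e \<notin> strong F"])
      (simp only: *)
  then show ?thesis
    using inj_prod[of v] by (simp add: card_image inj_on_subset wout_def)
qed

lemma leaf_iff: "v \<in> verts F \<Longrightarrow> f v \<in> leaves G \<longleftrightarrow> v \<in> leaves F"
  by (simp add: leaves_def out verts)

lemma leaves: "leaves G = f ` leaves F"
  using leaf_iff verts by (auto simp: leaves_def)

lemma root_iff: "v \<in> verts F \<Longrightarrow> f v \<in> roots G \<longleftrightarrow> v \<in> roots F"
proof -
  assume v: "v \<in> verts F"
  have "(\<exists>w. (w, f v) \<in> edges G) \<longleftrightarrow> (\<exists>u\<in>verts F. (f u, f v) \<in> edges G)"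
    using wf_forestD(5)[OF wf(2), unfolded verts] by blast
  also have "\<dots> \<longleftrightarrow> (\<exists>u. (u, v) \<in> edges F)"
    using v edge_iff wf_forestD(5)[OF wf(1)] by blast
  finally show ?thesis
    using v by (auto simp: roots_def verts)
qed

lemma roots: "roots G = f ` roots F"
  using root_iff verts by (auto simp: roots_def)

lemma tr: "tr G = tr F"
  unfolding tr_def roots using inj by (auto simp: roots_def intro: card_image inj_on_subset)

lemma relpow: "(u, v) \<in> edges F ^^ n \<Longrightarrow> (f u, f v) \<in> edges G ^^ n"
  by (induction n arbitrary: v) (auto intro: edge)

lemma relpow_iff:
  assumes "u \<in> verts F" "v \<in> verts F"
  shows "(f u, f v) \<in> edges G ^^ n \<longleftrightarrow> (u, v) \<in> edges F ^^ n"
  \<comment> \<open>The converse is the one-sided statement applied to the inverse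
    isomorphism.\<close>
  using relpow iso.relpow[OF inverse, of "f u" "f v" n] inj assms by auto

lemma level: "v \<in> verts F \<Longrightarrow> level G (f v) = level F v"
  unfolding level_def roots by (simp add: relpow_iff roots_def)

lemma rtrancl_iff:
  "u \<in> verts F \<Longrightarrow> v \<in> verts F \<Longrightarrow> (f u, f v) \<in> (edges G)\<^sup>* \<longleftrightarrow> (u, v) \<in> (edges F)\<^sup>*"
  by (simp add: rtrancl_is_UN_relpow relpow_iff)

lemma trancl_iff:
  "u \<in> verts F \<Longrightarrow> v \<in> verts F \<Longrightarrow> (f u, f v) \<in> (edges G)\<^sup>+ \<longleftrightarrow> (u, v) \<in> (edges F)\<^sup>+"
  by (auto simp: trancl_power relpow_iff)

lemma trivial_tail:
  assumes "trivial_tail_at F v"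
  shows "trivial_tail_at G (f v)"
proof -
  have v: "v \<in> verts F" "v \<notin> leaves F"
    using assms by (auto simp: trivial_tail_at_def)
  have "(edges G)\<^sup>* `` {f v} \<inter> leaves G = f ` ((edges F)\<^sup>* `` {v} \<inter> leaves F)"
    using v by (auto simp: leaves rtrancl_iff leaves_def[of F])
  moreover have "inj_on f ((edges F)\<^sup>* `` {v} \<inter> leaves F)"
    using inj by (rule inj_on_subset) (auto simp: leaves_def)
  moreover have "(edges G)\<^sup>* `` {f v} \<inter> strong G = f ` ((edges F)\<^sup>* `` {v} \<inter> strong F)"
    using v wf_forestD(7)[OF wf(1)] by (auto simp: strong rtrancl_iff)
  ultimately show ?thesis
    using assms v by (auto simp: trivial_tail_at_def card_out leaf_iff verts card_image)
qed

lemma minimal: "minimal F \<Longrightarrow> minimal G"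
  using iso.trivial_tail[OF inverse] by (auto simp: minimal_def)

lemma levelled:
  assumes "levelled_forest F"
  shows "levelled_forest G"
proof -
  have "acyclic (edges G)"
  proof (rule acyclicI, intro allI notI)
    fix x assume x: "(x, x) \<in> (edges G)\<^sup>+"
    then have "x \<in> verts G"
      using wf_forestD(5)[OF wf(2)] by (meson tranclD)
    then show False
      using x assms by (auto simp: verts trancl_iff levelled_forest_def acyclic_def)
  qed
  moreover have "u = u'" if "(u, v) \<in> edges G" "(u', v) \<in> edges G" for u u' v
  proof -
    have "u \<in> verts G" "u' \<in> verts G" "v \<in> verts G"
      using that wf_forestD[OF wf(2)] by blast+
    then show ?thesis
      using assms that unfolding levelled_forest_def verts
      by (auto simp: edge_iff) (metis edge_iff)
  qed
  moreover have "u \<in> strong G" if "(u, v) \<in> edges G" "v \<in> strong G" for u v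
  proof -
    have "u \<in> verts G" "v \<in> verts G"
      using that wf_forestD[OF wf(2)] by blast+
    then show ?thesis
      using assms that unfolding levelled_forest_def verts
      by (auto simp: edge_iff strong_iff) blast
  qed
  moreover have "strong G \<inter> leaves G = {}"
    using assms wf_forestD(7)[OF wf(1)]
    by (auto simp: strong leaf_iff levelled_forest_def)
  moreover have "\<forall>v\<in>strong G. \<forall>w\<in>strong G. level G v = level G w \<longrightarrow> v = w"
    using assms wf_forestD(7)[OF wf(1)]
    by (auto simp: strong level levelled_forest_def)
  ultimately show ?thesis
    using wf(2) unfolding levelled_forest_def wf_forest_def by blast
qed

end

section \<open>The order of the automorphism group as an isomorphism invariant\<close>

lemma finite_Aut: "finite (verts F) \<Longrightarrow> finite (Aut F)"
  by (rule finite_subset[OF _ finite_permutations]) (auto simp: Aut_def)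

text \<open>Conjugation by \<open>f\<close> embeds \<open>Aut F\<close> into \<open>Aut G\<close>;
  equality follows by applying this to the inverse of \<open>f\<close>.\<close>

lemma (in iso) card_Aut_le: "card (Aut F) \<le> card (Aut G)"
proof (rule card_inj_on_le)
  let ?g = "inv_into (verts F) f"
  \<comment> \<open>Members of \<open>Aut G\<close> fix everything outside \<open>verts G\<close>,
    so the conjugate is extended by the identity.\<close>
  define conj where "conj h x = (if x \<in> verts G then f (h (?g x)) else x)" for h x
  have conj_f: "conj h (f v) = f (h v)" if "v \<in> verts F" for h v
    using that inj verts by (simp add: conj_def)
  show "conj ` Aut F \<subseteq> Aut G"
  proof (rule image_subsetI)
    fix h assume h: "h \<in> Aut F"
    have "forest_iso ((f \<circ> h) \<circ> ?g) G G"
      using h iso forest_iso_trans[OF forest_iso_inv[OF iso] forest_iso_trans]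
      by (auto simp: Aut_def)
    then have conj: "forest_iso (conj h) G G"
      by (subst forest_iso_cong[of _ _ "(f \<circ> h) \<circ> ?g"]) (auto simp: conj_def)
    moreover have "conj h permutes verts G"
      by (rule bij_imp_permutes) (use conj in \<open>auto simp: forest_iso_def conj_def\<close>)
    ultimately show "conj h \<in> Aut G"
      by (simp add: Aut_def)
  qed
  show "inj_on conj (Aut F)"
  proof (rule inj_onI, rule ext)
    fix h k v assume h: "h \<in> Aut F" and k: "k \<in> Aut F" and eq: "conj h = conj k"
    show "h v = k v"
    proof (cases "v \<in> verts F")
      case True
      then have "f (h v) = f (k v)"
        using conj_f eq by metis
      moreover have "h v \<in> verts F" "k v \<in> verts F"
        using True h k by (auto simp: Aut_def permutes_in_image)
      ultimately show ?thesis
        by (simp add: inj_iff)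
    next
      case False
      then show ?thesis
        using h k by (auto simp: Aut_def permutes_def)
    qed
  qed
  show "finite (Aut G)"
    using wf by (simp add: finite_Aut wf_forest_def)
qed

lemma (in iso) card_Aut: "card (Aut G) = card (Aut F)"
  using card_Aut_le iso.card_Aut_le[OF inverse] by simp

subsection \<open>Levels and the size of a minimal forest\<close>

text \<open>The forest conditions without those on strong vertices. A graft can be shown to be a
  forest at this stage, before its levels, on which the strong-vertex conditions depend, have been
  computed.\<close>

definition oriented_forest :: "'a forest \<Rightarrow> bool" where
  "oriented_forest F \<longleftrightarrow> wf_forest F \<and> acyclic (edges F) \<and>
    (\<forall>u u' v. (u, v) \<in> edges F \<and> (u', v) \<in> edges F \<longrightarrow> u = u')"

lemma levelled_forest_iff:
  "levelled_forest F \<longleftrightarrow> oriented_forest F \<and> strong F \<inter> leaves F = {} \<and>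
     (\<forall>v\<in>strong F. \<forall>w\<in>strong F. level F v = level F w \<longrightarrow> v = w) \<and>
     (\<forall>u v. (u, v) \<in> edges F \<and> v \<in> strong F \<longrightarrow> u \<in> strong F)"
  unfolding levelled_forest_def oriented_forest_def wf_forest_def by blast

lemma oriented_imp_wf: "oriented_forest F \<Longrightarrow> wf_forest F"
  by (simp add: oriented_forest_def)

lemma levelled_imp_oriented: "levelled_forest F \<Longrightarrow> oriented_forest F"
  by (simp add: levelled_forest_iff)

lemma oriented_parent_unique:
  "oriented_forest F \<Longrightarrow> (u, v) \<in> edges F \<Longrightarrow> (u', v) \<in> edges F \<Longrightarrow> u = u'"
  by (auto simp: oriented_forest_def)

lemma not_leaf_iff: "v \<in> verts F \<Longrightarrow> v \<notin> leaves F \<longleftrightarrow> (\<exists>w. (v, w) \<in> edges F)"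
  by (auto simp: leaves_def out_def)

text \<open>A finite acyclic relation is well-founded, and every vertex that is not a root has a
  parent, so properties propagate from the roots along the edges.\<close>

lemma oriented_induct [consumes 2, case_names root edge]:
  assumes "oriented_forest F" "v \<in> verts F"
    and root: "\<And>r. r \<in> roots F \<Longrightarrow> P r"
    and edge: "\<And>u v. (u, v) \<in> edges F \<Longrightarrow> P u \<Longrightarrow> P v"
  shows "P v"
proof -
  have "wf (edges F)"
    using assms(1) wf_forestD(2) by (auto simp: oriented_forest_def intro: finite_acyclic_wf)
  then show ?thesis
    using assms(2)
  proof (induction v rule: wf_induct_rule)
    case (less v)
    show ?case
    proof (cases "v \<in> roots F")
      case False
      then obtain u where u: "(u, v) \<in> edges F"
        using less.prems by (auto simp: roots_def)
      then show ?thesis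
        using less.IH edge wf_forestD(5)[OF oriented_imp_wf[OF assms(1)]] by blast
    qed (rule root)
  qed
qed

lemma reachable_from_root:
  assumes "oriented_forest F" "v \<in> verts F"
  shows "\<exists>r\<in>roots F. (r, v) \<in> (edges F)\<^sup>*"
  using assms by (induction rule: oriented_induct) (auto intro: rtrancl_into_rtrancl)

lemma roots_nonempty: "oriented_forest F \<Longrightarrow> verts F \<noteq> {} \<Longrightarrow> roots F \<noteq> {}"
  using reachable_from_root by fastforce

lemma level_root: "r \<in> roots F \<Longrightarrow> level F r = 1"
  by (auto simp: level_def intro!: Least_eq_0 exI[of _ r])

text \<open>A path from a root to \<open>v\<close> has positive length because \<open>v\<close> has
  a parent, and its last edge starts at the unique parent \<open>u\<close>. Hence the least path
  length to \<open>v\<close> is one more than that to \<open>u\<close>.\<close>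

lemma level_edge:
  assumes "oriented_forest F" "(u, v) \<in> edges F"
  shows "level F v = Suc (level F u)"
proof -
  let ?P = "\<lambda>v n. \<exists>r\<in>roots F. (r, v) \<in> edges F ^^ n"
  have "u \<in> verts F"
    using wf_forestD(5)[OF oriented_imp_wf[OF assms(1)] assms(2)] .
  then obtain n where n: "?P u n"
    using reachable_from_root[OF assms(1)] by (meson rtrancl_power)
  have parent: "(w, v) \<in> edges F \<longleftrightarrow> w = u" for w
    using assms(2) oriented_parent_unique[OF assms(1)] by blast
  have Suc: "?P v (Suc n) \<longleftrightarrow> ?P u n" for n
    by (auto simp: parent relcomp_unfold)
  have "\<not> ?P v 0"
    using assms(2) by (auto simp: roots_def)
  moreover have "?P v (Suc n)"
    using n Suc by blast
  ultimately have "(LEAST n. ?P v n) = Suc (LEAST n. ?P v (Suc n))"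
    using Least_Suc[of "?P v" "Suc n"] by blast
  then show ?thesis
    unfolding level_def by (simp add: Suc del: relpow.simps)
qed

lemma level_pos: "level F v > 0"
  by (simp add: level_def)

lemma level_eq_1_iff:
  assumes "oriented_forest F" "v \<in> verts F"
  shows "level F v = 1 \<longleftrightarrow> v \<in> roots F"
proof
  assume 1: "level F v = 1"
  show "v \<in> roots F"
  proof (rule ccontr)
    assume "v \<notin> roots F"
    then obtain u where "(u, v) \<in> edges F"
      using assms by (auto simp: roots_def)
    then show False
      using 1 level_edge[OF assms(1)] level_pos[of F u] by fastforce
  qed
qed (rule level_root)

text \<open>The exponent of \<open>g\<^bsub>l(v)\<^esub>\<close> in the monomial of a non-leaf vertex \<open>v\<close>, in either series.\<close>

definition excess :: "'a forest \<Rightarrow> 'a \<Rightarrow> nat" where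
  "excess F v = (if v \<in> strong F then card (wout F v) else card (out F v) - 1)"

text \<open>This is the whole monomial of a strong tree in \<open>Q_B\<close>, and the part without
  \<open>g_0\<close> of the monomial of a weak forest in \<open>p_A\<close>.\<close>

definition level_mset :: "'a forest \<Rightarrow> nat multiset" where
  "level_mset F = (\<Sum>v\<in>verts F - leaves F. replicate_mset (excess F v) (level F v))"

lemma (in iso) level_mset: "level_mset G = level_mset F"
proof -
  have "level_mset G =
      (\<Sum>v\<in>f ` (verts F - leaves F). replicate_mset (excess G v) (level G v))"
    unfolding level_mset_def leaves verts
    using inj by (subst inj_on_image_set_diff[symmetric]) (auto simp: leaves_def)
  also have "\<dots> = (\<Sum>v\<in>verts F - leaves F. replicate_mset (excess G (f v)) (level G (f v)))"
    by (rule sum.reindex[unfolded comp_def]) (rule inj_on_subset[OF inj], auto)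
  also have "\<dots> = level_mset F"
    unfolding level_mset_def
    by (rule sum.cong) (auto simp: excess_def strong_iff card_out card_wout level)
  finally show ?thesis .
qed

lemma count_level_mset:
  assumes "finite (verts F)"
  shows "count (level_mset F) l = (\<Sum>v | v \<in> verts F - leaves F \<and> level F v = l. excess F v)"
proof -
  have "count (level_mset F) l = (\<Sum>v\<in>verts F - leaves F. if level F v = l then excess F v else 0)"
    unfolding level_mset_def count_sum by (intro sum.cong) auto
  also have "\<dots> = (\<Sum>v | v \<in> verts F - leaves F \<and> level F v = l. excess F v)"
    using assms by (intro sum.inter_filter[symmetric]) auto
  finally show ?thesis .
qed

text \<open>A strong vertex of exponent 0 has only strong children, which are not leaves. A weak one
  has a single child; were it a leaf, the two vertices would form a trivial tail, contrary to
  minimality.\<close>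

lemma excess_eq_0:
  assumes F: "levelled_forest F" "minimal F" and v: "v \<in> verts F" "v \<notin> leaves F" "excess F v = 0"
  shows "\<exists>w. (v, w) \<in> edges F \<and> w \<notin> leaves F"
proof (cases "v \<in> strong F")
  case True
  have fin: "finite (wout F v)"
    using wf_forestD(3)[OF levelled_imp_wf[OF F(1)]] by (simp add: wout_def)
  obtain w where w: "(v, w) \<in> edges F"
    using v not_leaf_iff[OF v(1)] by metis
  moreover have "wout F v = {}"
    using True v(3) fin by (simp add: excess_def)
  ultimately have "w \<in> strong F"
    by (auto simp: wout_def out_def)
  then show ?thesis
    using F(1) w by (auto simp: levelled_forest_def)
next
  case False
  \<comment> \<open>The subtraction in \<open>excess\<close> is truncated, but \<open>v\<close> is
    not a leaf, so exponent 0 leaves exactly one outgoing edge.\<close>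
  have "card (out F v) = 1"
    using False v wf_forestD(3)[OF levelled_imp_wf[OF F(1)], of v]
    by (auto simp: excess_def leaves_def le_Suc_eq)
  then obtain e where e: "out F v = {e}"
    by (rule card_1_singletonE)
  then have "e \<in> out F v"
    by simp
  then obtain w where e_eq: "e = (v, w)"
    by (cases e) (auto simp: out_def)
  have "(v, x) \<in> out F v \<longleftrightarrow> x = w" for x
    by (simp add: e e_eq)
  then have w: "(v, w) \<in> edges F" "\<And>x. (v, x) \<in> edges F \<Longrightarrow> x = w"
    by (simp_all add: out_def)
  show ?thesis
  proof (rule ccontr)
    assume "\<not> ?thesis"
    then have leaf: "w \<in> leaves F"
      using w(1) by auto
    have reach: "x = v \<or> x = w" if "(v, x) \<in> (edges F)\<^sup>*" for x
      using that
    proof induction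
      case (step y z)
      then show ?case
        using w(2) leaf by (auto simp: leaves_def out_def)
    qed simp
    have reach_eq: "(edges F)\<^sup>* `` {v} = {v, w}"
      using reach w(1) by auto
    have "w \<notin> strong F"
      using leaf F(1) by (auto simp: levelled_forest_def)
    moreover have "{v, w} \<inter> leaves F = {w}"
      using leaf v(2) by auto
    ultimately have "trivial_tail_at F v"
      using v False e reach_eq by (auto simp: trivial_tail_at_def)
    then show False
      using F(2) by (simp add: minimal_def)
  qed
qed

text \<open>All children of a non-leaf vertex of greatest level are leaves, so
  \<open>excess_eq_0\<close> forbids exponent 0 there. Both the height bound and the description of
  one-leaf forests rest on this vertex.\<close>

lemma deepest_nonleaf:
  assumes F: "levelled_forest F" "minimal F" and "verts F - leaves F \<noteq> {}"
  obtains v where "v \<in> verts F - leaves F" "\<And>w. w \<in> verts F - leaves F \<Longrightarrow> level F w \<le> level F v"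
    "excess F v > 0" "\<And>w. (v, w) \<in> edges F \<Longrightarrow> w \<in> leaves F"
proof -
  let ?N = "verts F - leaves F"
  have fin: "finite ?N"
    using wf_forestD(1)[OF levelled_imp_wf[OF F(1)]] by simp
  have "Max (level F ` ?N) \<in> level F ` ?N"
    using fin assms(3) by (intro Max_in) auto
  then obtain v where v: "v \<in> ?N" "level F v = Max (level F ` ?N)"
    by fastforce
  have max: "level F w \<le> level F v" if "w \<in> ?N" for w
    using that fin v(2) by simp
  have leaf: "w \<in> leaves F" if "(v, w) \<in> edges F" for w
    using max[of w] level_edge[OF levelled_imp_oriented[OF F(1)] that]
      wf_forestD(6)[OF levelled_imp_wf[OF F(1)] that] by fastforce
  have "excess F v > 0"
    using excess_eq_0[OF F] v(1) leaf by blast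
  then show ?thesis
    using that v(1) max leaf by blast
qed

lemma leaf_exists:
  assumes "oriented_forest F" "verts F \<noteq> {}"
  shows "leaves F \<noteq> {}"
proof -
  have "finite (verts F)"
    using assms(1) by (auto simp: oriented_forest_def wf_forest_def)
  then have "Max (level F ` verts F) \<in> level F ` verts F"
    using assms(2) by (intro Max_in) auto
  then obtain v where v: "v \<in> verts F" "level F v = Max (level F ` verts F)"
    by fastforce
  have "(v, w) \<notin> edges F" for w
  proof
    assume "(v, w) \<in> edges F"
    then have "level F w = Suc (level F v)" "w \<in> verts F"
      using level_edge[OF assms(1)] wf_forestD(6)[OF oriented_imp_wf[OF assms(1)]] by blast+
    moreover from this have "level F w \<le> Max (level F ` verts F)"
      using \<open>finite (verts F)\<close> by (intro Max_ge finite_imageI imageI)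
    ultimately show False
      using v(2) by linarith
  qed
  then show ?thesis
    using v(1) not_leaf_iff[OF v(1)] by blast
qed

text \<open>A deepest non-leaf vertex would have the single leaf as its only child, hence exponent
  0, although its exponent is positive. So there are no non-leaf vertices at all.\<close>

lemma single_leaf:
  assumes F: "levelled_forest F" "minimal F" "strong F = {}" "card (leaves F) = 1"
  shows "card (verts F) = 1" "edges F = {}"
proof -
  obtain x where x: "leaves F = {x}"
    using F(4) by (rule card_1_singletonE)
  have no_nonleaf: "verts F - leaves F = {}"
  proof (rule ccontr)
    assume "verts F - leaves F \<noteq> {}"
    then obtain v where v: "v \<in> verts F - leaves F" "excess F v > 0"
        "\<And>w. (v, w) \<in> edges F \<Longrightarrow> w \<in> leaves F"
      using deepest_nonleaf[OF F(1,2)] by metis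
    have "out F v \<subseteq> {(v, x)}"
      using v(3) x by (auto simp: out_def)
    then have "card (out F v) \<le> 1"
      using card_mono[of "{(v, x)}" "out F v"] by simp
    then show False
      using v(2) F(3) by (simp add: excess_def)
  qed
  then have "verts F = leaves F"
    by (auto simp: leaves_def)
  then show "card (verts F) = 1"
    using F(4) by simp
  show "edges F = {}"
    using no_nonleaf wf_forestD(5)[OF levelled_imp_wf[OF F(1)]] by (force simp: leaves_def out_def)
qed

text \<open>Children of one vertex share a level, so at most one of them is strong:
  \<open>wout\<close> misses at most one outgoing edge of a strong vertex. For a weak vertex the
  bound is the definition of \<open>excess\<close>.\<close>

lemma card_out_le_excess:
  assumes F: "levelled_forest F"
  shows "card (out F v) \<le> Suc (excess F v)"
proof (cases "v \<in> strong F")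
  case True
  let ?S = "{e \<in> out F v. snd e \<in> strong F}"
  note fin = wf_forestD(3)[OF levelled_imp_wf[OF F], of v]
  have "e = e'" if "e \<in> ?S" "e' \<in> ?S" for e e'
  proof -
    have e: "fst e = v" "fst e' = v" "e \<in> edges F" "e' \<in> edges F"
        "snd e \<in> strong F" "snd e' \<in> strong F"
      using that by (auto simp: out_def)
    then have "level F (snd e) = level F (snd e')"
      using level_edge[OF levelled_imp_oriented[OF F]] by (metis prod.collapse)
    then have "snd e = snd e'"
      using F e(5,6) unfolding levelled_forest_iff by blast
    then show ?thesis
      using e(1,2) by (simp add: prod_eq_iff)
  qed
  then have "card ?S \<le> 1"
    using fin by (auto simp: card_le_Suc0_iff_eq)
  moreover have "card (out F v) = card (wout F v) + card ?S"
    using fin by (subst card_Un_disjoint[symmetric]) (auto simp: wout_def intro: arg_cong[of _ _ card])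
  ultimately show ?thesis
    using True by (simp add: excess_def)
qed (simp add: excess_def)

text \<open>A vertex has at most one child more than its exponent, so passing from level
  \<open>l\<close> to \<open>l + 1\<close> adds at most the exponent of \<open>g_l\<close>. Level 0
  is empty and level 1 consists of the \<open>tr F\<close> roots.\<close>

lemma card_level_le:
  assumes F: "levelled_forest F"
  shows "card {v \<in> verts F. level F v = l} \<le> tr F + (\<Sum>j<l. count (level_mset F) j)"
proof (induction l)
  case 0
  then show ?case by (simp add: level_def)
next
  case (Suc l)
  note wf = levelled_imp_wf[OF F] and oriented = levelled_imp_oriented[OF F]
  note fin = wf_forestD(1)[OF wf]
  show ?case
  proof (cases "l = 0")
    case True
    then have "{v \<in> verts F. level F v = Suc l} = roots F"
      using level_eq_1_iff[OF oriented] by (auto simp: roots_def)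
    then show ?thesis
      by (simp add: tr_def)
  next
    case False
    let ?L = "{v \<in> verts F. level F v = l}"
    have "{v \<in> verts F. level F v = Suc l} \<subseteq> snd ` (\<Union>u\<in>?L. out F u)"
    proof
      fix v assume v: "v \<in> {v \<in> verts F. level F v = Suc l}"
      then have "v \<notin> roots F"
        using False level_root[of v F] by auto
      then obtain u where u: "(u, v) \<in> edges F"
        using v by (auto simp: roots_def)
      then have "u \<in> ?L"
        using v level_edge[OF oriented] wf_forestD(5)[OF wf] by fastforce
      then show "v \<in> snd ` (\<Union>u\<in>?L. out F u)"
        using u by (force simp: out_def)
    qed
    moreover have fin_out: "finite (\<Union>u\<in>?L. out F u)"
      using fin wf_forestD(3)[OF wf] by simp
    ultimately have "card {v \<in> verts F. level F v = Suc l} \<le> card (\<Union>u\<in>?L. out F u)"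
      using surj_card_le by blast
    also have "\<dots> \<le> (\<Sum>u\<in>?L. card (out F u))"
      using fin by (intro card_UN_le) simp
    \<comment> \<open>Leaves have no children, so counting 1 for each is generous; it lets the sum
      split into the size of the level and the exponent of \<open>g_l\<close>.\<close>
    also have "\<dots> \<le> (\<Sum>u\<in>?L. 1 + (if u \<in> leaves F then 0 else excess F u))"
      using card_out_le_excess[OF F] by (intro sum_mono) (auto simp: leaves_def)
    also have "\<dots> = card ?L + (\<Sum>u\<in>?L. if u \<in> leaves F then 0 else excess F u)"
      by (simp only: sum.distrib card_eq_sum)
    also have "(\<Sum>u\<in>?L. if u \<in> leaves F then 0 else excess F u) = count (level_mset F) l"
      unfolding count_level_mset[OF fin] using fin by (intro sum.mono_neutral_cong_right) auto
    finally show ?thesis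
      using Suc.IH by simp
  qed
qed

text \<open>The deepest non-leaf vertex puts its own level into the monomial, so non-leaf vertices
  lie below \<open>h\<close> and their children at level at most \<open>h\<close>. The bound is
  \<open>Suc h\<close> because roots have level 1 even when \<open>h\<close> is 0.\<close>

lemma level_le:
  assumes F: "levelled_forest F" "minimal F" and h: "\<And>l. l \<ge> h \<Longrightarrow> l \<notin># level_mset F"
    and v: "v \<in> verts F"
  shows "level F v \<le> Suc h"
proof (cases "v \<in> roots F")
  case True
  then show ?thesis by (simp add: level_root)
next
  case False
  note wf = levelled_imp_wf[OF F(1)] and oriented = levelled_imp_oriented[OF F(1)]
  obtain u where u: "(u, v) \<in> edges F"
    using v False by (auto simp: roots_def)
  then have u_nonleaf: "u \<in> verts F - leaves F"
    using wf_forestD(5)[OF wf u] by (auto simp: leaves_def out_def)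
  then have "verts F - leaves F \<noteq> {}"
    by blast
  from deepest_nonleaf[OF F this] obtain w where w: "w \<in> verts F - leaves F" "excess F w > 0"
      "\<And>x. x \<in> verts F - leaves F \<Longrightarrow> level F x \<le> level F w"
    by metis
  have "level F w \<in># level_mset F"
  proof -
    have "excess F w \<le> count (level_mset F) (level F w)"
      unfolding count_level_mset[OF wf_forestD(1)[OF wf]]
      by (rule member_le_sum) (use w(1) wf_forestD(1)[OF wf] in auto)
    then show ?thesis
      using w(2) by (auto simp flip: count_greater_zero_iff)
  qed
  then have "level F u < h"
    using h w(3)[OF u_nonleaf] by (meson le_less_trans not_le)
  then show ?thesis
    using level_edge[OF oriented u] by simp
qed

text \<open>The bound depends only on the number of trees and on the monomial, which is what local
  finiteness of the sums requires.\<close>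

lemma card_verts_le:
  assumes F: "levelled_forest F" "minimal F" and h: "\<And>l. l \<ge> h \<Longrightarrow> l \<notin># level_mset F"
  shows "card (verts F) \<le> (\<Sum>l\<le>Suc h. tr F + (\<Sum>j<l. count (level_mset F) j))"
proof -
  define L where "L l = {v \<in> verts F. level F v = l}" for l
  have verts: "verts F = (\<Union>l\<le>Suc h. L l)"
    using level_le[OF assms] by (auto simp: L_def)
  have "card (verts F) \<le> (\<Sum>l\<le>Suc h. card (L l))"
    by (subst verts) (rule card_UN_le, simp)
  also have "\<dots> \<le> (\<Sum>l\<le>Suc h. tr F + (\<Sum>j<l. count (level_mset F) j))"
    unfolding L_def by (intro sum_mono card_level_le F)
  finally show ?thesis .
qed

subsection \<open>Grafting onto a strong root\<close>

lemma image_mset_sum: "image_mset f (\<Sum>x\<in>A. g x) = (\<Sum>x\<in>A. image_mset f (g x))"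
  by (induction A rule: infinite_finite_induct) auto

text \<open>\<open>X\<close> is a union of connected components of \<open>T\<close> with its root \<open>r\<close> removed.\<close>

locale branch =
  fixes r :: 'a and T X :: "'a forest"
  assumes oriented_T: "oriented_forest T" and oriented_X: "oriented_forest X"
    and r_root: "r \<in> roots T" and r_notin: "r \<notin> verts X" and verts_sub: "verts X \<subseteq> verts T"
    and edge_iff: "\<And>u v. u \<in> verts X \<Longrightarrow> (u, v) \<in> edges T \<longleftrightarrow> (u, v) \<in> edges X"
    and edge_root: "\<And>v. v \<in> roots X \<Longrightarrow> (r, v) \<in> edges T"
    and strong_iff: "\<And>v. v \<in> verts X \<Longrightarrow> v \<in> strong T \<longleftrightarrow> v \<in> strong X"
begin

lemma edge_X:
  assumes "(u, v) \<in> edges X"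
  shows "u \<in> verts X" "v \<in> verts X" "(u, v) \<in> edges T"
  using assms edge_iff wf_forestD(5,6)[OF oriented_imp_wf[OF oriented_X]] by blast+

lemma out_eq: "v \<in> verts X \<Longrightarrow> out T v = out X v"
  by (auto simp: out_def edge_iff)

lemma wout_eq: "v \<in> verts X \<Longrightarrow> wout T v = wout X v"
  using edge_X(2) strong_iff unfolding wout_def by (auto simp: out_eq) (auto simp: out_def)

lemma leaf_iff: "v \<in> verts X \<Longrightarrow> v \<in> leaves T \<longleftrightarrow> v \<in> leaves X"
  using verts_sub by (auto simp: leaves_def out_eq)

lemma excess_eq: "v \<in> verts X \<Longrightarrow> excess T v = excess X v"
  by (simp add: excess_def strong_iff out_eq wout_eq)

text \<open>The roots of \<open>X\<close> are children of \<open>r\<close>, which has level 1 in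
  \<open>T\<close>, and both levels grow by one along every edge of \<open>X\<close>.\<close>

lemma level_eq:
  assumes "v \<in> verts X"
  shows "level T v = Suc (level X v)"
  using oriented_X assms
proof (induction rule: oriented_induct)
  case (root v)
  then show ?case
    using level_edge[OF oriented_T edge_root] by (simp add: level_root r_root)
next
  case (edge u v)
  then show ?case
    using level_edge[OF oriented_T edge_X(3)] level_edge[OF oriented_X] by simp
qed

text \<open>No edge of \<open>T\<close> leaves \<open>verts X\<close>, so the subtree below a vertex
  of \<open>X\<close> is the same in both forests; this makes trivial tails a local matter.\<close>

lemma reachable:
  assumes "v \<in> verts X"
  shows "(v, w) \<in> (edges T)\<^sup>* \<longleftrightarrow> (v, w) \<in> (edges X)\<^sup>*" "(v, w) \<in> (edges T)\<^sup>* \<Longrightarrow> w \<in> verts X"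
proof -
  have *: "(v, w) \<in> (edges X)\<^sup>* \<and> w \<in> verts X" if "(v, w) \<in> (edges T)\<^sup>*"
    using that
    by induction (use assms edge_iff edge_X(2) in \<open>auto intro: rtrancl_into_rtrancl\<close>)
  moreover have "(edges X)\<^sup>* \<subseteq> (edges T)\<^sup>*"
    using edge_X(3) by (intro rtrancl_mono) auto
  ultimately show "(v, w) \<in> (edges T)\<^sup>* \<longleftrightarrow> (v, w) \<in> (edges X)\<^sup>*"
    by blast
  show "(v, w) \<in> (edges T)\<^sup>* \<Longrightarrow> w \<in> verts X"
    using * by blast
qed

lemma trivial_tail_iff:
  assumes "v \<in> verts X"
  shows "trivial_tail_at T v \<longleftrightarrow> trivial_tail_at X v"
proof -
  have reach: "(edges T)\<^sup>* `` {v} = (edges X)\<^sup>* `` {v}"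
    using reachable(1)[OF assms] by auto
  have "(edges T)\<^sup>* `` {v} \<inter> leaves T = (edges X)\<^sup>* `` {v} \<inter> leaves X"
    and "(edges T)\<^sup>* `` {v} \<inter> strong T = (edges X)\<^sup>* `` {v} \<inter> strong X"
    using reachable[OF assms] leaf_iff strong_iff by blast+
  then show ?thesis
    using assms verts_sub by (auto simp: trivial_tail_at_def leaf_iff out_eq)
qed

lemma level_mset_eq:
  "(\<Sum>v\<in>verts X - leaves X. replicate_mset (excess T v) (level T v)) = image_mset Suc (level_mset X)"
  unfolding level_mset_def image_mset_sum
  by (intro sum.cong) (auto simp: excess_eq level_eq)

end

definition graft :: "'a \<Rightarrow> 'a forest \<Rightarrow> 'a forest \<Rightarrow> 'a forest" where
  "graft r S W = \<lparr>verts = insert r (verts S \<union> verts W),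
     edges = edges S \<union> edges W \<union> {r} \<times> (roots S \<union> roots W), strong = insert r (strong S)\<rparr>"

text \<open>The condition \<open>roots S \<subseteq> strong S\<close> covers both intended cases, a
  strong tree and the empty forest. Nonemptiness of the union keeps the strong root \<open>r\<close>
  from being a leaf.\<close>

locale grafting =
  fixes r :: 'a and S W :: "'a forest"
  assumes oriented: "oriented_forest S" "oriented_forest W"
    and disjoint: "verts S \<inter> verts W = {}" and fresh: "r \<notin> verts S" "r \<notin> verts W"
    and nonempty: "verts S \<union> verts W \<noteq> {}"
    and roots_strong: "roots S \<subseteq> strong S" and not_strong: "strong W = {}"
begin

abbreviation T :: "'a forest" where "T \<equiv> graft r S W"

lemma wf_parts: "wf_forest S" "wf_forest W"
  using oriented by (simp_all add: oriented_imp_wf)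

lemma graft_simps:
  "verts T = insert r (verts S \<union> verts W)"
  "edges T = edges S \<union> edges W \<union> {r} \<times> (roots S \<union> roots W)"
  "strong T = insert r (strong S)"
  by (simp_all add: graft_def)

lemma part_edges:
  "(u, v) \<in> edges S \<Longrightarrow> u \<in> verts S \<and> v \<in> verts S \<and> u \<noteq> r \<and> v \<noteq> r \<and> u \<notin> verts W \<and> v \<notin> verts W"
  "(u, v) \<in> edges W \<Longrightarrow> u \<in> verts W \<and> v \<in> verts W \<and> u \<noteq> r \<and> v \<noteq> r \<and> u \<notin> verts S \<and> v \<notin> verts S"
  using wf_forestD(5,6)[OF wf_parts(1)] wf_forestD(5,6)[OF wf_parts(2)] disjoint fresh by blast+

lemma part_roots:
  "v \<in> roots S \<Longrightarrow> v \<in> verts S \<and> v \<noteq> r \<and> v \<notin> verts W \<and> (u, v) \<notin> edges S"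
  "v \<in> roots W \<Longrightarrow> v \<in> verts W \<and> v \<noteq> r \<and> v \<notin> verts S \<and> (u, v) \<notin> edges W"
  using disjoint fresh by (auto simp: roots_def)

lemma wf_T: "wf_forest T"
  using wf_parts part_roots by (auto simp: wf_forest_def graft_simps)

lemma oriented_T: "oriented_forest T"
proof -
  \<comment> \<open>Every edge of the graft strictly increases this rank, which rules out
    cycles.\<close>
  define rank where
    "rank v = (if v = r then 0 else if v \<in> verts S then level S v else level W v)" for v
  have "edges T \<subseteq> inv_image less_than rank"
    using part_edges part_roots level_edge[OF oriented(1)] level_edge[OF oriented(2)]
    by (auto simp: graft_simps rank_def level_pos)
  then have "acyclic (edges T)"
    by (meson acyclic_subset wf_acyclic wf_inv_image wf_less_than)
  moreover have "u = u'" if "(u, v) \<in> edges T" "(u', v) \<in> edges T" for u u' v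
    using that part_edges part_roots oriented_parent_unique[OF oriented(1)]
      oriented_parent_unique[OF oriented(2)] by (auto simp: graft_simps) blast+
  ultimately show ?thesis
    using wf_T unfolding oriented_forest_def by blast
qed

lemma roots_T: "roots T = {r}"
proof -
  have "(u, r) \<notin> edges T" for u
    by (auto simp: graft_simps dest: part_edges part_roots)
  moreover have "\<exists>u. (u, v) \<in> edges T" if "v \<in> verts S \<union> verts W" for v
    using that by (cases "v \<in> roots S \<union> roots W") (auto simp: graft_simps roots_def)
  ultimately show ?thesis
    by (fastforce simp: roots_def graft_simps(1))
qed

lemma edge_r_iff: "(r, v) \<in> edges T \<longleftrightarrow> v \<in> roots S \<or> v \<in> roots W"
  by (auto simp: graft_simps dest: part_edges)

lemma nonempty_roots: "roots S \<union> roots W \<noteq> {}"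
  using nonempty roots_nonempty oriented by blast

lemma r_not_leaf: "r \<in> verts T" "r \<notin> leaves T"
  using nonempty_roots not_leaf_iff[of r T] by (auto simp: graft_simps)

sublocale S: branch r T S
proof
  show "v \<in> strong T \<longleftrightarrow> v \<in> strong S" if "v \<in> verts S" for v
    using that fresh by (auto simp: graft_simps)
qed (use oriented oriented_T roots_T disjoint fresh part_edges part_roots in \<open>auto simp: graft_simps\<close>)

sublocale W: branch r T W
proof
  show "v \<in> strong T \<longleftrightarrow> v \<in> strong W" if "v \<in> verts W" for v
    using that fresh disjoint not_strong wf_forestD(7)[OF wf_parts(1)] by (auto simp: graft_simps)
qed (use oriented oriented_T roots_T disjoint fresh part_edges part_roots in \<open>auto simp: graft_simps\<close>)

lemma leaves_T: "leaves T = leaves S \<union> leaves W"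
  using r_not_leaf S.leaf_iff W.leaf_iff by (auto simp: leaves_def graft_simps)

text \<open>No trivial tail starts at \<open>r\<close>, since the subtree below \<open>r\<close>
  contains the strong vertex \<open>r\<close> itself; elsewhere trivial tails are those of the
  parts.\<close>

lemma minimal_iff: "minimal T \<longleftrightarrow> minimal S \<and> minimal W"
proof -
  have "\<not> trivial_tail_at T r"
    by (auto simp: trivial_tail_at_def graft_simps)
  moreover have "v \<in> verts F" if "trivial_tail_at F v" for F and v :: 'a
    using that by (simp add: trivial_tail_at_def)
  ultimately show ?thesis
    unfolding minimal_def using S.trivial_tail_iff W.trivial_tail_iff
    by (auto simp: graft_simps) (metis Un_iff graft_simps(1) insert_iff)+
qed

text \<open>The new root is the only strong vertex on level 1, and the strong vertices of
  \<open>S\<close> all move up by one level, so coincidences of levels are unchanged.\<close>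

lemma levelled_iff: "levelled_forest T \<longleftrightarrow> levelled_forest S \<and> levelled_forest W"
proof -
  have strong_S: "v \<in> verts S" "v \<noteq> r" "v \<notin> verts W" if "v \<in> strong S" for v
    using that wf_forestD(7)[OF wf_parts(1)] fresh disjoint by auto
  have levels: "level T v = Suc (level S v)" "level T v \<noteq> level T r" if "v \<in> strong S" for v
    using that strong_S S.level_eq[of v] level_pos[of S v] by (auto simp: level_root roots_T)
  have "(\<forall>v\<in>strong T. \<forall>w\<in>strong T. level T v = level T w \<longrightarrow> v = w) \<longleftrightarrow>
      (\<forall>v\<in>strong S. \<forall>w\<in>strong S. level S v = level S w \<longrightarrow> v = w)"
    using levels by (fastforce simp: graft_simps)
  moreover have "(\<forall>u v. (u, v) \<in> edges T \<and> v \<in> strong T \<longrightarrow> u \<in> strong T) \<longleftrightarrow>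
      (\<forall>u v. (u, v) \<in> edges S \<and> v \<in> strong S \<longrightarrow> u \<in> strong S)"
    using part_edges part_roots strong_S by (auto simp: graft_simps) blast+
  moreover have "strong T \<inter> leaves T = {} \<longleftrightarrow> strong S \<inter> leaves S = {}"
    using strong_S r_not_leaf by (auto simp: leaves_T graft_simps) (auto simp: leaves_def)
  ultimately show ?thesis
    by (simp add: levelled_forest_iff oriented oriented_T not_strong)
qed

text \<open>The children of \<open>r\<close> are the roots of both parts. Those of \<open>S\<close>
  are strong, so exactly the roots of \<open>W\<close> are counted.\<close>

lemma card_wout_r: "card (wout T r) = tr W"
proof -
  have "wout T r = {r} \<times> roots W"
    using subsetD[OF roots_strong] wf_forestD(7)[OF wf_parts(1)]
    by (auto simp: wout_def out_def edge_r_iff graft_simps(3) dest: part_roots(2))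
  then show ?thesis
    by (simp add: tr_def card_cartesian_product)
qed

lemma level_mset_T:
  "level_mset T =
     replicate_mset (tr W) 1 + image_mset Suc (level_mset S) + image_mset Suc (level_mset W)"
proof -
  let ?f = "\<lambda>v. replicate_mset (excess T v) (level T v)"
  let ?NS = "verts S - leaves S" and ?NW = "verts W - leaves W"
  have nonleaves: "verts T - leaves T = insert r (?NS \<union> ?NW)"
    using r_not_leaf S.leaf_iff W.leaf_iff by (auto simp: graft_simps)
  have fin: "finite ?NS" "finite ?NW"
    using wf_parts wf_forestD(1) by auto
  have "level_mset T = ?f r + (sum ?f ?NS + sum ?f ?NW)"
    unfolding level_mset_def nonleaves using fin fresh disjoint
    by (subst sum.insert, simp, simp, subst sum.union_disjoint) auto
  moreover have "?f r = replicate_mset (tr W) 1"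
    by (simp add: excess_def graft_simps(3) card_wout_r level_root roots_T)
  ultimately show ?thesis
    by (simp only: S.level_mset_eq W.level_mset_eq add.assoc)
qed

lemma sum_wout_T: "(\<Sum>v\<in>strong T. card (wout T v)) = tr W + (\<Sum>v\<in>strong S. card (wout S v))"
proof -
  have "(\<Sum>v\<in>strong T. card (wout T v)) = card (wout T r) + (\<Sum>v\<in>strong S. card (wout T v))"
    unfolding graft_simps
    using wf_forestD(4,7)[OF wf_parts(1)] fresh by (subst sum.insert) auto
  also have "(\<Sum>v\<in>strong S. card (wout T v)) = (\<Sum>v\<in>strong S. card (wout S v))"
    using wf_forestD(7)[OF wf_parts(1)] by (simp add: S.wout_eq)
  finally show ?thesis
    by (simp add: card_wout_r)
qed

end

text \<open>An isomorphism matches the unique roots. Roots of \<open>S\<close> are strong children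
  of \<open>r\<close> and roots of \<open>W\<close> weak ones, so labels decide into which part each
  is sent, and the rest of the part follows along the edges.\<close>

lemma forest_iso_graft_iff:
  assumes "grafting r S W" "grafting r' S' W'"
  shows "forest_iso f (graft r S W) (graft r' S' W') \<longleftrightarrow>
    f r = r' \<and> forest_iso f S S' \<and> forest_iso f W W'"
proof
  interpret A: grafting r S W by fact
  interpret B: grafting r' S' W' by fact
  {
    assume "forest_iso f A.T B.T"
    then interpret iso f A.T B.T
      by (rule iso.intro) (rule A.wf_T B.wf_T)+
    have r: "f r = r'"
      using roots by (simp add: A.roots_T B.roots_T)
    \<comment> \<open>Roots of \<open>S\<close> go to strong vertices other than \<open>r'\<close>,
      and every such vertex lies in \<open>S'\<close>; children then stay in the branch.\<close>
    have S: "f v \<in> verts S'" if "v \<in> verts S" for v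
      using A.oriented(1) that
    proof (induction rule: oriented_induct)
      case (root v)
      have v: "v \<in> verts A.T" "v \<noteq> r"
        using A.part_roots(1)[OF root] by (auto simp: A.graft_simps)
      have "v \<in> strong A.T"
        using root A.roots_strong by (auto simp: A.graft_simps)
      then have "f v \<in> strong B.T"
        using strong_iff v by blast
      moreover have "f v \<noteq> r'"
        using inj_iff[of v r] v A.r_not_leaf r by simp
      ultimately show ?case
        using wf_forestD(7)[OF B.wf_parts(1)] by (auto simp: B.graft_simps)
    next
      case (edge u v)
      then show ?case
        using iso.edge[OF iso_axioms, OF A.S.edge_X(3)] B.S.edge_iff B.S.edge_X(2) by blast
    qed
    \<comment> \<open>The image of a root of \<open>W\<close> is a child of \<open>r'\<close> that
      is not strong, so it cannot be a root of \<open>S'\<close> and must be one of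
      \<open>W'\<close>.\<close>
    have W: "f v \<in> verts W'" if "v \<in> verts W" for v
      using A.oriented(2) that
    proof (induction rule: oriented_induct)
      case (root v)
      have v: "v \<in> verts A.T" "v \<in> verts W"
        using A.part_roots(2)[OF root] by (auto simp: A.graft_simps)
      then have "v \<notin> strong A.T"
        using A.W.strong_iff A.not_strong by blast
      then have "f v \<notin> roots S'"
        using strong_iff v(1) B.roots_strong by (auto simp: B.graft_simps)
      moreover have "(r', f v) \<in> edges B.T"
        using iso.edge[OF iso_axioms, OF A.W.edge_root[OF root]] r by simp
      ultimately show ?case
        using B.part_edges B.part_roots(2) by (auto simp: B.graft_simps)
    next
      case (edge u v)
      then show ?case
        using iso.edge[OF iso_axioms, OF A.W.edge_X(3)] B.W.edge_iff B.W.edge_X(2) by blast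
    qed
    have "insert r' (verts S' \<union> verts W') = insert r' (f ` verts S \<union> f ` verts W)"
      using verts r by (simp add: A.graft_simps(1) B.graft_simps(1) image_Un)
    moreover have "f ` verts S \<subseteq> verts S'" "f ` verts W \<subseteq> verts W'"
      using S W by auto
    \<comment> \<open>Subsets of two disjoint sets that together cover their union must exhaust
      both; this gives surjectivity onto each part.\<close>
    moreover have "A' = A \<and> B' = B"
      if "insert x (A \<union> B) = insert x (A' \<union> B')" "A' \<subseteq> A" "B' \<subseteq> B" "A \<inter> B = {}" "x \<notin> A" "x \<notin> B"
      for x :: 'b and A B A' B'
      using that by (auto simp: set_eq_iff subset_iff)
    ultimately have "f ` verts S = verts S'" "f ` verts W = verts W'"
      using B.disjoint B.fresh by metis+
    moreover have "inj_on f (verts S)" "inj_on f (verts W)"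
      using inj by (auto intro: inj_on_subset simp: A.graft_simps)
    moreover have "(u, v) \<in> edges S \<longleftrightarrow> (f u, f v) \<in> edges S'" if "u \<in> verts S" "v \<in> verts S" for u v
      using that edge_iff[of u v] A.S.edge_iff[OF that(1), of v] B.S.edge_iff[OF S[OF that(1)], of "f v"]
      by (simp add: A.graft_simps(1))
    moreover have "(u, v) \<in> edges W \<longleftrightarrow> (f u, f v) \<in> edges W'" if "u \<in> verts W" "v \<in> verts W" for u v
      using that edge_iff[of u v] A.W.edge_iff[OF that(1), of v] B.W.edge_iff[OF W[OF that(1)], of "f v"]
      by (simp add: A.graft_simps(1))
    moreover have "v \<in> strong S \<longleftrightarrow> f v \<in> strong S'" if "v \<in> verts S" for v
      using that strong_iff[of v] A.S.strong_iff[OF that] B.S.strong_iff[OF S[OF that]]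
      by (simp add: A.graft_simps(1))
    ultimately show "f r = r' \<and> forest_iso f S S' \<and> forest_iso f W W'"
      using r by (simp add: forest_iso_def bij_betw_def A.not_strong B.not_strong)
  }
  assume f: "f r = r' \<and> forest_iso f S S' \<and> forest_iso f W W'"
  interpret S: iso f S S'
    using f A.wf_parts B.wf_parts by unfold_locales auto
  interpret W: iso f W W'
    using f A.wf_parts B.wf_parts by unfold_locales auto
  have "bij_betw f (verts S \<union> verts W) (verts S' \<union> verts W')"
    using f B.disjoint by (intro bij_betw_combine) (auto simp: forest_iso_def)
  then have "bij_betw f (verts A.T) (verts B.T)"
    using notIn_Un_bij_betw[of r "verts S \<union> verts W" f "verts S' \<union> verts W'"] f A.fresh B.fresh
    by (simp add: A.graft_simps(1) B.graft_simps(1))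
  moreover have S: "f v \<in> verts S'" "f v \<notin> verts W'" "f v \<noteq> r'" if "v \<in> verts S" for v
    using that S.verts B.disjoint B.fresh by auto
  moreover have W: "f v \<in> verts W'" "f v \<notin> verts S'" "f v \<noteq> r'" if "v \<in> verts W" for v
    using that W.verts B.disjoint B.fresh by auto
  have "(u, v) \<in> edges A.T \<longleftrightarrow> (f u, f v) \<in> edges B.T" if v: "u \<in> verts A.T" "v \<in> verts A.T" for u v
  proof -
    consider "u \<in> verts S" | "u \<in> verts W" | "u = r"
      using v by (auto simp: A.graft_simps)
    then show ?thesis
    proof cases
      case 1
      have "(u, v) \<in> edges S \<longleftrightarrow> (f u, f v) \<in> edges S'"
      proof (cases "v \<in> verts S")
        case True
        then show ?thesis
          by (simp add: 1 S.edge_iff)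
      next
        case False
        then have "f v \<notin> verts S'"
          using v(2) W(2)[of v] f B.fresh by (auto simp: A.graft_simps(1))
        then show ?thesis
          using False A.part_edges(1)[of u v] B.part_edges(1)[of "f u" "f v"] by blast
      qed
      then show ?thesis
        by (simp only: A.S.edge_iff[OF 1] B.S.edge_iff[OF S(1)[OF 1]])
    next
      case 2
      have "(u, v) \<in> edges W \<longleftrightarrow> (f u, f v) \<in> edges W'"
      proof (cases "v \<in> verts W")
        case True
        then show ?thesis
          by (simp add: 2 W.edge_iff)
      next
        case False
        then have "f v \<notin> verts W'"
          using v(2) S(2)[of v] f B.fresh by (auto simp: A.graft_simps(1))
        then show ?thesis
          using False A.part_edges(2)[of u v] B.part_edges(2)[of "f u" "f v"] by blast
      qed
      then show ?thesis
        by (simp only: A.W.edge_iff[OF 2] B.W.edge_iff[OF W(1)[OF 2]])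
    next
      case 3
      have "v \<in> roots S \<or> v \<in> roots W \<longleftrightarrow> f v \<in> roots S' \<or> f v \<in> roots W'"
      proof -
        consider "v = r" | "v \<in> verts S" | "v \<in> verts W"
          using v(2) by (auto simp: A.graft_simps(1))
        then show ?thesis
        proof cases
          case 1
          then show ?thesis
            using f A.part_roots B.part_roots by blast
        next
          case 2
          then show ?thesis
            using S.root_iff[OF 2] S(2)[OF 2] A.disjoint by (auto simp: roots_def[of W] roots_def[of W'])
        next
          case 3
          then show ?thesis
            using W.root_iff[OF 3] W(2)[OF 3] A.disjoint by (auto simp: roots_def[of S] roots_def[of S'])
        qed
      qed
      then show ?thesis
        using f 3 by (simp add: A.edge_r_iff B.edge_r_iff)
    qed
  qed
  moreover have "v \<in> strong A.T \<longleftrightarrow> f v \<in> strong B.T" if v: "v \<in> verts A.T" for v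
  proof -
    consider "v = r" | "v \<in> verts S" | "v \<in> verts W"
      using v by (auto simp: A.graft_simps(1))
    then show ?thesis
    proof cases
      case 1
      then show ?thesis
        using f by (simp add: A.graft_simps(3) B.graft_simps(3))
    next
      case 2
      then show ?thesis
        using S.strong_iff[OF 2] A.S.strong_iff[OF 2] B.S.strong_iff[OF S(1)[OF 2]] by simp
    next
      case 3
      then show ?thesis
        using W.strong_iff[OF 3] A.W.strong_iff[OF 3] B.W.strong_iff[OF W(1)[OF 3]] by simp
    qed
  qed
  ultimately show "forest_iso f A.T B.T"
    unfolding forest_iso_def by blast
qed

text \<open>Automorphisms of the parts act on disjoint vertex sets and fix everything else, so
  \<open>g \<circ> h\<close> acts as \<open>g\<close> on \<open>S\<close> and as \<open>h\<close> on
  \<open>W\<close>. By \<open>forest_iso_graft_iff\<close> every automorphism of the graft arises in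
  this way, from a unique pair.\<close>

lemma (in grafting) card_Aut_T: "card (Aut T) = card (Aut S) * card (Aut W)"
proof -
  have split: "forest_iso f T T \<longleftrightarrow> f r = r \<and> forest_iso f S S \<and> forest_iso f W W" for f
    by (rule forest_iso_graft_iff) (rule grafting_axioms)+
  have comp: "(g \<circ> h) v = (if v \<in> verts W then h v else g v)" if "g \<in> Aut S" "h \<in> Aut W" for g h v
  proof (cases "v \<in> verts W")
    case True
    then have "h v \<in> verts W"
      using that(2) by (simp add: Aut_def permutes_in_image)
    then have "h v \<notin> verts S"
      using disjoint by blast
    then show ?thesis
      using that(1) True permutes_not_in[of g "verts S" "h v"] by (simp add: Aut_def)
  next
    case False
    then show ?thesis
      using that(2) permutes_not_in[of h "verts W" v] by (simp add: Aut_def)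
  qed
  have "bij_betw (\<lambda>(g, h). g \<circ> h) (Aut S \<times> Aut W) (Aut T)"
  proof (rule bij_betw_imageI)
    show "inj_on (\<lambda>(g, h). g \<circ> h) (Aut S \<times> Aut W)"
    proof (rule inj_onI, clarify)
      fix g h g' h' assume gh: "g \<in> Aut S" "h \<in> Aut W" "g' \<in> Aut S" "h' \<in> Aut W"
        and eq: "g \<circ> h = g' \<circ> h'"
      have eq': "(if v \<in> verts W then h v else g v) = (if v \<in> verts W then h' v else g' v)" for v
        using comp[OF gh(1,2)] comp[OF gh(3,4)] eq by metis
      have "h v = v" "h' v = v" if "v \<notin> verts W" for v
        using gh that by (auto simp: Aut_def permutes_def)
      moreover have "g v = v" "g' v = v" if "v \<in> verts W" for v
        using gh that disjoint by (auto simp: Aut_def permutes_def)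
      ultimately show "g = g' \<and> h = h'"
        using eq' by (metis ext)
    qed
    show "(\<lambda>(g, h). g \<circ> h) ` (Aut S \<times> Aut W) = Aut T"
    proof (intro set_eqI iffI)
      fix f assume "f \<in> (\<lambda>(g, h). g \<circ> h) ` (Aut S \<times> Aut W)"
      then obtain g h where f: "f = g \<circ> h" and gh: "g \<in> Aut S" "h \<in> Aut W"
        by auto
      have f_S: "f v = g v" if "v \<in> verts S" for v
        using comp[OF gh, of v] that disjoint by (auto simp: f)
      have f_W: "f v = h v" if "v \<in> verts W" for v
        using comp[OF gh, of v] that by (simp add: f)
      have "f r = r"
        using gh fresh by (simp add: f Aut_def permutes_not_in[of g "verts S"] permutes_not_in[of h "verts W"])
      moreover have "forest_iso f S S"
        using gh by (subst forest_iso_cong[of S f g]) (auto simp: f_S Aut_def)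
      moreover have "forest_iso f W W"
        using gh by (subst forest_iso_cong[of W f h]) (auto simp: f_W Aut_def)
      moreover have "f permutes verts T"
        unfolding f using gh
        by (intro permutes_compose) (auto simp: Aut_def graft_simps intro: permutes_subset)
      ultimately show "f \<in> Aut T"
        by (simp add: Aut_def split)
    next
      fix f assume f: "f \<in> Aut T"
      define g where "g v = (if v \<in> verts S then f v else v)" for v
      define h where "h v = (if v \<in> verts W then f v else v)" for v
      have iso: "f r = r" "forest_iso f S S" "forest_iso f W W"
        using f split by (auto simp: Aut_def)
      have "forest_iso g S S" "forest_iso h W W"
        using iso forest_iso_cong[of S g f] forest_iso_cong[of W h f] by (auto simp: g_def h_def)
      then have gh: "g \<in> Aut S" "h \<in> Aut W"
        by (auto simp: Aut_def forest_iso_def g_def h_def intro!: bij_imp_permutes)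
      have "f v = v" if "v \<notin> verts S" "v \<notin> verts W" for v
        using f that iso(1) by (cases "v = r") (auto simp: Aut_def permutes_def graft_simps)
      then have "f = g \<circ> h"
        by (intro ext) (simp only: comp[OF gh], auto simp: g_def h_def)
      then show "f \<in> (\<lambda>(g, h). g \<circ> h) ` (Aut S \<times> Aut W)"
        using gh by auto
    qed
  qed
  then show ?thesis
    by (metis bij_betw_same_card card_cartesian_product)
qed

subsection \<open>Decomposition of strong trees\<close>

definition isomorphic :: "'a forest \<Rightarrow> 'b forest \<Rightarrow> bool" where
  "isomorphic F G \<longleftrightarrow> (\<exists>f. forest_iso f F G)"

lemma isomorphic_refl: "isomorphic F F"
  and isomorphic_sym: "isomorphic F G \<Longrightarrow> isomorphic G F"
  and isomorphic_trans: "isomorphic F G \<Longrightarrow> isomorphic G H \<Longrightarrow> isomorphic F H"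
  unfolding isomorphic_def by (blast intro: forest_iso_id forest_iso_inv forest_iso_trans)+

lemma isomorphic_imp_iso:
  assumes "isomorphic F G" "wf_forest F" "wf_forest G"
  obtains f where "iso f F G"
  using assms by (auto simp: isomorphic_def iso_def)

lemma isomorphic_card_leaves:
  assumes "isomorphic F G" "wf_forest F" "wf_forest G"
  shows "card (leaves F) = card (leaves G)"
proof -
  obtain f where "iso f F G"
    using assms by (rule isomorphic_imp_iso)
  then interpret iso f F G .
  show ?thesis
    unfolding leaves
    by (rule card_image[symmetric], rule inj_on_subset[OF inj]) (auto simp: leaves_def)
qed

text \<open>Backwards, two unrelated isomorphisms are glued into one map. This is possible because
  the parts are disjoint and \<open>forest_iso\<close> depends only on values at vertices.\<close>

lemma graft_isomorphic_iff:
  assumes "grafting r S W" "grafting r' S' W'"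
  shows "isomorphic (graft r S W) (graft r' S' W') \<longleftrightarrow> isomorphic S S' \<and> isomorphic W W'"
proof
  assume "isomorphic (graft r S W) (graft r' S' W')"
  then show "isomorphic S S' \<and> isomorphic W W'"
    unfolding isomorphic_def forest_iso_graft_iff[OF assms] by blast
next
  interpret grafting r S W by fact
  assume "isomorphic S S' \<and> isomorphic W W'"
  then obtain g h where g: "forest_iso g S S'" and h: "forest_iso h W W'"
    by (auto simp: isomorphic_def)
  define f where "f v = (if v = r then r' else if v \<in> verts S then g v else h v)" for v
  have "f v = g v" if "v \<in> verts S" for v
    using that fresh by (auto simp: f_def)
  moreover have "f v = h v" if "v \<in> verts W" for v
    using that fresh disjoint by (auto simp: f_def)
  ultimately have "f r = r' \<and> forest_iso f S S' \<and> forest_iso f W W'"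
    using forest_iso_cong[of S f g] forest_iso_cong[of W f h] g h by (simp add: f_def)
  then show "isomorphic (graft r S W) (graft r' S' W')"
    unfolding isomorphic_def forest_iso_graft_iff[OF assms] by blast
qed

section \<open>Relabelling and restriction of forests\<close>

definition relabel :: "('a \<Rightarrow> 'b) \<Rightarrow> 'a forest \<Rightarrow> 'b forest" where
  "relabel f F = \<lparr>verts = f ` verts F, edges = map_prod f f ` edges F, strong = f ` strong F\<rparr>"

lemma iso_relabel:
  assumes "wf_forest F" "inj_on f (verts F)"
  shows "iso f F (relabel f F)"
proof (rule iso.intro)
  show "wf_forest (relabel f F)"
    using assms(1) by (auto simp: wf_forest_def relabel_def)
  have "(f u, f v) \<in> map_prod f f ` edges F \<longleftrightarrow> (u, v) \<in> edges F"
    if uv: "u \<in> verts F" "v \<in> verts F" for u v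
  proof
    assume "(f u, f v) \<in> map_prod f f ` edges F"
    then obtain x y where xy: "(x, y) \<in> edges F" "f x = f u" "f y = f v"
      by auto
    then have "x = u" "y = v"
      using uv wf_forestD(5,6)[OF assms(1) xy(1)] inj_onD[OF assms(2)] by blast+
    then show "(u, v) \<in> edges F"
      using xy(1) by simp
  qed (force intro: rev_image_eqI)
  moreover have "f v \<in> f ` strong F \<longleftrightarrow> v \<in> strong F" if "v \<in> verts F" for v
    using that assms by (auto simp: wf_forest_def inj_on_image_mem_iff)
  ultimately show "forest_iso f F (relabel f F)"
    using assms(2) by (auto simp: forest_iso_def relabel_def bij_betw_def)
qed fact

definition restrict_forest :: "'a set \<Rightarrow> 'a forest \<Rightarrow> 'a forest" where
  "restrict_forest X F = \<lparr>verts = X, edges = edges F \<inter> X \<times> X, strong = strong F \<inter> X\<rparr>"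

lemma restrict_forest_simps [simp]:
  "verts (restrict_forest X F) = X" "edges (restrict_forest X F) = edges F \<inter> X \<times> X"
  "strong (restrict_forest X F) = strong F \<inter> X"
  by (simp_all add: restrict_forest_def)

text \<open>By \<open>closed\<close>, edges not starting at \<open>r\<close> neither enter nor leave
  \<open>X\<close>. Cutting the edges from \<open>r\<close> thus turns exactly the children of
  \<open>r\<close> in \<open>X\<close> into roots.\<close>

lemma restrict_branch:
  assumes T: "oriented_forest T" "roots T = {r}" and X: "X \<subseteq> verts T" "r \<notin> X"
    and closed: "\<And>u v. (u, v) \<in> edges T \<Longrightarrow> u \<noteq> r \<Longrightarrow> u \<in> X \<longleftrightarrow> v \<in> X"
  shows "oriented_forest (restrict_forest X T)"
    and "roots (restrict_forest X T) = {v \<in> X. (r, v) \<in> edges T}"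
proof -
  have "finite X"
    using X(1) wf_forestD(1)[OF oriented_imp_wf[OF T(1)]] by (rule finite_subset)
  moreover have "acyclic (edges T \<inter> X \<times> X)"
    using T(1) by (auto simp: oriented_forest_def intro: acyclic_subset)
  ultimately show "oriented_forest (restrict_forest X T)"
    using oriented_parent_unique[OF T(1)] by (auto simp: oriented_forest_def wf_forest_def)
  show "roots (restrict_forest X T) = {v \<in> X. (r, v) \<in> edges T}"
  proof (intro set_eqI iffI)
    fix v assume v: "v \<in> roots (restrict_forest X T)"
    then have "v \<in> X" "v \<in> verts T" "v \<notin> roots T"
      using X T(2) by (auto simp: roots_def[of "restrict_forest X T"])
    then obtain u where u: "(u, v) \<in> edges T"
      by (auto simp: roots_def)
    with v \<open>v \<in> X\<close> closed[OF u] have "u = r"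
      by (auto simp: roots_def)
    with u \<open>v \<in> X\<close> show "v \<in> {v \<in> X. (r, v) \<in> edges T}"
      by simp
  next
    fix v assume "v \<in> {v \<in> X. (r, v) \<in> edges T}"
    then show "v \<in> roots (restrict_forest X T)"
      using X(2) oriented_parent_unique[OF T(1), of r v] by (auto simp: roots_def)
  qed
qed

text \<open>The index set of \<open>1 + p_A\<close>: besides \<open>forests_A\<close> it admits the
  empty forest and the single leaf.\<close>

definition weak_forests :: "nat forest set" where
  "weak_forests = {F. levelled_forest F \<and> strong F = {} \<and> minimal F}"

definition empty_forests :: "nat forest set" where
  "empty_forests = {F \<in> weak_forests. card (leaves F) = 0}"

lemma empty_forests_verts: "F \<in> empty_forests \<Longrightarrow> verts F = {}"
  using leaf_exists levelled_imp_oriented wf_forestD(1)[OF levelled_imp_wf]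
  unfolding empty_forests_def weak_forests_def leaves_def by fastforce

text \<open>The parent of a strong vertex is strong, so a single strong vertex makes the root of its
  tree strong.\<close>

lemma roots_subset_strong:
  assumes "S \<in> trees_B \<union> empty_forests"
  shows "roots S \<subseteq> strong S"
proof (cases "S \<in> trees_B")
  case True
  then have S: "levelled_forest S" "tr S = 1" "strong S \<noteq> {}"
    by (auto simp: trees_B_def)
  then obtain r where r: "roots S = {r}"
    by (auto simp: tr_def card_1_singleton_iff)
  obtain v where v: "v \<in> strong S"
    using S(3) by blast
  then have "v \<in> verts S"
    using wf_forestD(7)[OF levelled_imp_wf[OF S(1)]] by blast
  with levelled_imp_oriented[OF S(1)] have "v \<in> strong S \<longrightarrow> r \<in> strong S"
  proof (induction rule: oriented_induct)
    case (edge u v)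
    then show ?case
      using S(1) unfolding levelled_forest_iff by blast
  qed (simp add: r)
  then show ?thesis
    using v r by simp
next
  case False
  then show ?thesis
    using assms empty_forests_verts by (auto simp: roots_def)
qed

lemma graft_in_trees_B:
  assumes "grafting r S W" and S: "S \<in> trees_B \<union> empty_forests" and W: "W \<in> weak_forests"
  shows "graft r S W \<in> trees_B"
proof -
  interpret grafting r S W by fact
  have "leaves T \<noteq> {}"
    by (rule leaf_exists[OF oriented_T]) (simp add: graft_simps)
  moreover have "finite (leaves T)"
    using wf_forestD(1)[OF wf_T] by (simp add: leaves_def)
  ultimately have "card (leaves T) \<ge> 1"
    by (metis One_nat_def Suc_leI card_gt_0_iff)
  moreover have "levelled_forest T" "minimal T"
    using S W
    by (auto simp: levelled_iff minimal_iff trees_B_def empty_forests_def weak_forests_def)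
  ultimately show ?thesis
    by (simp add: trees_B_def tr_def roots_T graft_simps(3))
qed

lemma trees_B_cases:
  assumes "T \<in> trees_B"
  obtains r S W where "T = graft r S W" "grafting r S W"
    "S \<in> trees_B \<union> empty_forests" "W \<in> weak_forests"
proof -
  have T: "levelled_forest T" "minimal T" and oriented: "oriented_forest T"
    using assms levelled_imp_oriented by (auto simp: trees_B_def)
  note wf = oriented_imp_wf[OF oriented]
  obtain r where r: "roots T = {r}"
    using assms by (auto simp: trees_B_def tr_def card_1_singleton_iff)
  have r_strong: "r \<in> strong T"
    using roots_subset_strong[of T] assms r by simp
  have r_vert: "r \<in> verts T"
    using r by (auto simp: roots_def)
  have into_r: "(u, r) \<notin> edges T" for u
    using r by (auto simp: roots_def)
  have reach_r: "u = r" if "(u, r) \<in> (edges T)\<^sup>*" for u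
    using that into_r by (meson rtranclE)
  \<comment> \<open>\<open>U\<close> collects the subtrees at strong children of the root and is
    empty if the root is the only strong vertex; \<open>X\<close> below takes all remaining
    components.\<close>
  define U where "U = {v. \<exists>s\<in>strong T. (r, s) \<in> edges T \<and> (s, v) \<in> (edges T)\<^sup>*}"
  define X where "X = verts T - {r} - U"
  let ?S = "restrict_forest U T" and ?W = "restrict_forest X T"
  \<comment> \<open>If such a child were a proper descendant of a strong child \<open>s\<close>, its
    parent \<open>r\<close> would be reachable from \<open>s\<close>, which is impossible for a
    root. So it is \<open>s\<close> itself.\<close>
  have child_U: "v \<in> strong T" if v: "v \<in> U" "(r, v) \<in> edges T" for v
  proof -
    obtain s where s: "s \<in> strong T" "(r, s) \<in> edges T" "(s, v) \<in> (edges T)\<^sup>*"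
      using v(1) by (auto simp: U_def)
    show ?thesis
      using s(3)
    proof (cases rule: rtranclE)
      case (step y)
      then have "s = r"
        using v(2) oriented_parent_unique[OF oriented] reach_r by metis
      then show ?thesis
        using s(2) into_r by blast
    qed (use s in simp)
  qed
  have U_closed: "u \<in> U \<longleftrightarrow> v \<in> U" if "(u, v) \<in> edges T" "u \<noteq> r" for u v
  proof
    assume "u \<in> U"
    then show "v \<in> U"
      using that(1) by (auto simp: U_def intro: rtrancl_into_rtrancl)
  next
    assume "v \<in> U"
    then obtain s where s: "s \<in> strong T" "(r, s) \<in> edges T" "(s, v) \<in> (edges T)\<^sup>*"
      by (auto simp: U_def)
    show "u \<in> U"
      using s(3)
    proof (cases rule: rtranclE)
      case base
      then show ?thesis
        using s(2) that oriented_parent_unique[OF oriented] by metis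
    next
      case (step y)
      then have "y = u"
        using that(1) oriented_parent_unique[OF oriented] by metis
      then show ?thesis
        using s step by (auto simp: U_def)
    qed
  qed
  have U_sub: "U \<subseteq> verts T"
  proof
    fix v assume "v \<in> U"
    then have "(r, v) \<in> (edges T)\<^sup>+"
      by (auto simp: U_def intro: rtrancl_into_trancl2)
    then show "v \<in> verts T"
      using wf_forestD(6)[OF wf] by (meson tranclD2)
  qed
  have U_r: "r \<notin> U"
    using reach_r into_r by (auto simp: U_def)
  have X_closed: "u \<in> X \<longleftrightarrow> v \<in> X" if "(u, v) \<in> edges T" "u \<noteq> r" for u v
    using that U_closed[OF that] wf_forestD(5,6)[OF wf that(1)] into_r by (auto simp: X_def)
  have X_sub: "X \<subseteq> verts T" "r \<notin> X"
    by (auto simp: X_def)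
  note S = restrict_branch[OF oriented r U_sub U_r U_closed]
  note W = restrict_branch[OF oriented r X_sub X_closed]
  \<comment> \<open>A strong vertex has a strong parent. If that parent is \<open>r\<close>, the
    vertex is a strong child and lies in \<open>U\<close>; otherwise \<open>U\<close> is inherited
    from the parent.\<close>
  have strong_U: "v = r \<or> v \<in> U" if "v \<in> strong T" for v
  proof -
    have "v \<in> strong T \<longrightarrow> v = r \<or> v \<in> U"
      using oriented wf_forestD(7)[OF wf that]
    proof (induction rule: oriented_induct)
      case (edge u v)
      then have "u \<in> strong T" if "v \<in> strong T"
        using that T(1) unfolding levelled_forest_iff by blast
      then show ?case
        using edge U_closed[OF edge(1)] by (auto simp: U_def)
    qed (simp add: r)
    then show ?thesis
      using that by blast
  qed
  have eq: "T = graft r ?S ?W"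
  proof (rule forest.equality)
    show "verts T = verts (graft r ?S ?W)"
      using U_sub r_vert by (auto simp: graft_def X_def)
    show "strong T = strong (graft r ?S ?W)"
      using strong_U r_strong by (auto simp: graft_def)
    show "edges T = edges (graft r ?S ?W)"
    proof (rule set_eqI, clarify)
      fix u v
      have "(u, v) \<in> edges T \<Longrightarrow> v \<in> U \<or> v \<in> X"
        using wf_forestD(6)[OF wf] into_r by (auto simp: X_def)
      moreover have "(u, v) \<in> edges T \<Longrightarrow> u \<noteq> r \<Longrightarrow> v \<in> U \<Longrightarrow> u \<in> U"
        and "(u, v) \<in> edges T \<Longrightarrow> u \<noteq> r \<Longrightarrow> v \<in> X \<Longrightarrow> u \<in> X"
        using U_closed X_closed by blast+
      ultimately show "(u, v) \<in> edges T \<longleftrightarrow> (u, v) \<in> edges (graft r ?S ?W)"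
        by (auto simp: graft_def S(2) W(2))
    qed
  qed simp
  have strong_W: "strong ?W = {}"
    using strong_U X_sub by (auto simp: X_def)
  have roots_S: "roots ?S \<subseteq> strong ?S"
    using child_U by (auto simp: S(2))
  have "r \<notin> leaves T"
    using T(1) r_strong by (auto simp: levelled_forest_iff)
  then obtain w where "(r, w) \<in> edges T"
    using not_leaf_iff[OF r_vert] by blast
  then have "verts ?S \<union> verts ?W \<noteq> {}"
    using wf_forestD(6)[OF wf] into_r by (auto simp: X_def)
  then have grafting: "grafting r ?S ?W"
    using S(1) W(1) U_r roots_S strong_W by unfold_locales (auto simp: X_def)
  have parts: "levelled_forest ?S" "levelled_forest ?W" "minimal ?S" "minimal ?W"
    using T eq grafting.levelled_iff[OF grafting] grafting.minimal_iff[OF grafting] by simp_all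
  have "?S \<in> trees_B \<union> empty_forests"
  proof (cases "U = {}")
    case True
    then show ?thesis
      using parts by (simp add: empty_forests_def weak_forests_def leaves_def)
  next
    case False
    then obtain s where s: "s \<in> roots ?S"
      using roots_nonempty[OF S(1)] by auto
    \<comment> \<open>All roots of the strong part are strong and of level 1, and a level carries at
      most one strong vertex. Hence this part is a single tree.\<close>
    have "t = s" if "t \<in> roots ?S" for t
    proof -
      have "\<forall>v\<in>strong ?S. \<forall>w\<in>strong ?S. level ?S v = level ?S w \<longrightarrow> v = w"
        using parts(1) unfolding levelled_forest_iff by (elim conjE)
      moreover have "level ?S t = level ?S s"
        by (simp only: level_root[OF s] level_root[OF that])
      ultimately show ?thesis
        using subsetD[OF roots_S that] subsetD[OF roots_S s] by (simp only:)
    qed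
    then have "roots ?S = {s}"
      using s by blast
    then have "tr ?S = 1" "strong ?S \<noteq> {}"
      using s roots_S by (auto simp: tr_def)
    moreover have "leaves ?S \<noteq> {}" "finite (leaves ?S)"
      using leaf_exists[OF S(1)] False wf_forestD(1)[OF oriented_imp_wf[OF S(1)]]
      by (auto simp: leaves_def)
    then have "card (leaves ?S) \<ge> 1"
      by (metis One_nat_def Suc_leI card_gt_0_iff)
    ultimately show ?thesis
      using parts by (simp add: trees_B_def)
  qed
  moreover have "?W \<in> weak_forests"
    using parts strong_W by (simp add: weak_forests_def)
  ultimately show ?thesis
    using that eq grafting by blast
qed

subsection \<open>Sums over isomorphism classes\<close>

text \<open>One representative per isomorphism class, which turns a sum over classes into a sum over
  a plain set of forests.\<close>

definition transversal :: "nat forest set \<Rightarrow> nat forest set \<Rightarrow> bool" where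
  "transversal A R \<longleftrightarrow> R \<subseteq> A \<and> (\<forall>F\<in>A. \<exists>!G. G \<in> R \<and> isomorphic F G)"

lemma formal_sum_reindex:
  assumes "bij_betw h K I" "\<And>k. k \<in> K \<Longrightarrow> f (h k) = g k"
  shows "formal_sum I f = formal_sum K g"
proof (rule gseries_eqI)
  fix m
  let ?K = "{k. k \<in> K \<and> coeff (g k) m \<noteq> 0}"
  have "{i. i \<in> I \<and> coeff (f i) m \<noteq> 0} = h ` ?K" and "inj_on h ?K"
    using assms by (auto simp: bij_betw_def inj_on_def)
  then have "(\<Sum>i | i \<in> I \<and> coeff (f i) m \<noteq> 0. coeff (f i) m) = (\<Sum>k\<in>?K. coeff (g k) m)"
    using assms(2) by (simp add: sum.reindex)
  then show "coeff (formal_sum I f) m = coeff (formal_sum K g) m"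
    by (simp add: formal_sum_def)
qed

text \<open>Any family that meets each class exactly once can index the sum, since \<open>t\<close>
  is invariant and the member chosen by \<open>SOME\<close> is isomorphic to the member of the
  family. It serves for transversals and for the trees grafted from pairs.\<close>

lemma sum_up_to_iso_reindex:
  assumes \<phi>: "\<And>k. k \<in> K \<Longrightarrow> \<phi> k \<in> A"
    and unique: "\<And>F. F \<in> A \<Longrightarrow> \<exists>!k. k \<in> K \<and> isomorphic F (\<phi> k)"
    and inv: "\<And>F G. F \<in> A \<Longrightarrow> G \<in> A \<Longrightarrow> isomorphic F G \<Longrightarrow> t F = t G"
  shows "sum_up_to_iso A t = formal_sum K (\<lambda>k. t (\<phi> k))"
  unfolding sum_up_to_iso_def
proof (rule formal_sum_reindex)
  let ?c = "\<lambda>F. {G \<in> A. isomorphic F G}"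
  have classes: "iso_classes A = ?c ` A"
    unfolding iso_classes_def quotient_def isomorphic_def by auto
  have c_eq: "?c F = ?c G" if "isomorphic F G" for F G
    using isomorphic_trans[OF that] isomorphic_trans[OF isomorphic_sym[OF that]] by blast
  have "?c F \<in> (\<lambda>k. ?c (\<phi> k)) ` K" if "F \<in> A" for F
    using unique[OF that] c_eq by blast
  moreover have "j = k" if "j \<in> K" "k \<in> K" "?c (\<phi> j) = ?c (\<phi> k)" for j k
  proof -
    have "isomorphic (\<phi> j) (\<phi> k)"
      using that \<phi> isomorphic_refl by blast
    then show ?thesis
      using unique[OF \<phi>[OF that(1)]] that(1,2) isomorphic_refl by blast
  qed
  ultimately show "bij_betw (\<lambda>k. ?c (\<phi> k)) K (iso_classes A)"
    unfolding bij_betw_def inj_on_def classes using \<phi> by blast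
  fix k assume k: "k \<in> K"
  have "(SOME F. F \<in> ?c (\<phi> k)) \<in> ?c (\<phi> k)"
    by (rule someI[of _ "\<phi> k"]) (simp add: \<phi> k isomorphic_refl)
  then show "t (SOME F. F \<in> ?c (\<phi> k)) = t (\<phi> k)"
    using inv[OF \<phi>[OF k], of "SOME F. F \<in> ?c (\<phi> k)"] by simp
qed

lemma transversal_exists: "\<exists>R. transversal A R"
proof -
  define rep where "rep F = (SOME G. G \<in> A \<and> isomorphic F G)" for F :: "nat forest"
  have rep: "rep F \<in> A" "isomorphic F (rep F)" if "F \<in> A" for F
    using someI[of "\<lambda>G. G \<in> A \<and> isomorphic F G" F] that isomorphic_refl by (auto simp: rep_def)
  have "rep F = rep G" if "isomorphic F G" for F G :: "nat forest"
  proof -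
    have "isomorphic F H \<longleftrightarrow> isomorphic G H" for H :: "nat forest"
      using isomorphic_trans[OF that] isomorphic_trans[OF isomorphic_sym[OF that]] by blast
    then show ?thesis
      by (simp add: rep_def)
  qed
  then have "transversal A (rep ` A)"
    unfolding transversal_def using rep by (auto intro: isomorphic_trans) metis
  then show ?thesis ..
qed

text \<open>Here \<open>C\<close> is one further isomorphism class, separated from \<open>A\<close>
  and represented by \<open>N\<close>.\<close>

lemma transversal_insert:
  assumes R: "transversal A R" and N: "N \<in> C" "\<And>F. F \<in> C \<Longrightarrow> isomorphic F N"
    and sep: "\<And>F G. F \<in> A \<Longrightarrow> G \<in> C \<Longrightarrow> \<not> isomorphic F G"
  shows "transversal (A \<union> C) (insert N R)"
proof -
  have "\<exists>!G. G \<in> insert N R \<and> isomorphic F G" if F: "F \<in> A \<union> C" for F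
  proof (cases "F \<in> A")
    case True
    then show ?thesis
      using R sep[OF True N(1)] unfolding transversal_def by blast
  next
    case False
    then have "\<not> isomorphic F G" if "G \<in> R" for G
      using that F R sep isomorphic_sym unfolding transversal_def by blast
    then show ?thesis
      using False F N(2) by blast
  qed
  then show ?thesis
    using R N(1) by (auto simp: transversal_def)
qed

text \<open>Each forest has an isomorphic copy on an initial segment of \<open>nat\<close> within
  \<open>{..<N}\<close>, and there are finitely many such copies. Passing to copies is injective
  because distinct members of \<open>R\<close> are not isomorphic.\<close>

lemma finite_nonisomorphic:
  assumes wf: "\<And>F. F \<in> R \<Longrightarrow> wf_forest F" and bound: "\<And>F. F \<in> R \<Longrightarrow> card (verts F) \<le> N"
    and noniso: "\<And>F G. F \<in> R \<Longrightarrow> G \<in> R \<Longrightarrow> isomorphic F G \<Longrightarrow> F = G"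
  shows "finite (R :: nat forest set)"
proof -
  have "\<exists>f. bij_betw f (verts F) {0..<card (verts F)}" if "F \<in> R" for F
    using ex_bij_betw_finite_nat wf_forestD(1)[OF wf[OF that]] by blast
  then obtain f where f: "\<And>F. F \<in> R \<Longrightarrow> bij_betw (f F) (verts F) {0..<card (verts F)}"
    by metis
  define g where "g F = relabel (f F) F" for F
  have iso_g: "isomorphic F (g F)" if "F \<in> R" for F
    using iso.iso[OF iso_relabel[OF wf[OF that] bij_betw_imp_inj_on[OF f[OF that]]]]
    by (auto simp: isomorphic_def g_def)
  have "inj_on g R"
    using iso_g noniso isomorphic_sym isomorphic_trans unfolding inj_on_def by metis
  moreover have "finite (g ` R)"
  proof (rule finite_subset)
    let ?P = "Pow {..<N} \<times> Pow ({..<N} \<times> {..<N}) \<times> Pow {..<N}"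
    show "g ` R \<subseteq> (\<lambda>(V, E, S). \<lparr>verts = V, edges = E, strong = S\<rparr>) ` ?P"
    proof (rule image_subsetI)
      fix F assume F: "F \<in> R"
      have "f F v < N" if "v \<in> verts F" for v
        using bij_betwE[OF f[OF F]] bound[OF F] that by fastforce
      moreover note wf_forestD(5-7)[OF wf[OF F]]
      ultimately have "(f F ` verts F, map_prod (f F) (f F) ` edges F, f F ` strong F) \<in> ?P"
        by auto
      then show "g F \<in> (\<lambda>(V, E, S). \<lparr>verts = V, edges = E, strong = S\<rparr>) ` ?P"
        unfolding g_def relabel_def by (rule rev_image_eqI) simp
    qed
  qed simp
  ultimately show ?thesis
    by (rule finite_imageD[rotated])
qed

text \<open>Local finiteness of the series. The number of trees is bounded separately because
  \<open>level_mset\<close> does not record the exponent of \<open>g_0\<close>.\<close>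

lemma finite_level_mset_fibre:
  assumes R: "\<And>F. F \<in> R \<Longrightarrow> levelled_forest F \<and> minimal F"
    and noniso: "\<And>F G. F \<in> R \<Longrightarrow> G \<in> R \<Longrightarrow> isomorphic F G \<Longrightarrow> F = G"
  shows "finite {F \<in> (R :: nat forest set). tr F \<le> k \<and> level_mset F \<subseteq># m}"
proof -
  obtain h where h: "l < h" if "l \<in># m" for l
    using finite_nat_set_iff_bounded[of "set_mset m"] by auto
  show ?thesis
  proof (rule finite_nonisomorphic)
    fix F assume "F \<in> {F \<in> R. tr F \<le> k \<and> level_mset F \<subseteq># m}"
    then have F: "levelled_forest F" "minimal F" "tr F \<le> k" "level_mset F \<subseteq># m"
      using R by auto
    show "wf_forest F"
      using F(1) by (rule levelled_imp_wf)
    have "card (verts F) \<le> (\<Sum>l\<le>Suc h. tr F + (\<Sum>j<l. count (level_mset F) j))"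
      by (rule card_verts_le[OF F(1,2)]) (use h mset_subset_eqD[OF F(4)] in force)
    also have "\<dots> \<le> (\<Sum>l\<le>Suc h. k + (\<Sum>j<l. count m j))"
      using F(3,4) by (intro sum_mono add_mono) (auto simp: subseteq_mset_def)
    finally show "card (verts F) \<le> (\<Sum>l\<le>Suc h. k + (\<Sum>j<l. count m j))" .
  qed (use noniso in auto)
qed

subsection \<open>The weights\<close>

lemma half_gvar_power_gmon: "(gconst c * gvar l) ^ n = gmon (c ^ n) (replicate_mset n l)"
  and gvar_power_gmon: "gvar l ^ n = gmon 1 (replicate_mset n l)"
  by (induction n) (auto simp: one_eq_gmon gconst_eq_gmon gvar_eq_gmon gmon_mult)

definition half_exponent :: "'a forest \<Rightarrow> nat" where
  "half_exponent F = (\<Sum>v\<in>strong F. card (wout F v))"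

text \<open>One coefficient for both series: without strong vertices \<open>half_exponent\<close> is
  0, and the inverse order of the automorphism group remains.\<close>

definition weight :: "'a forest \<Rightarrow> rat" where
  "weight F = (1 / 2) ^ half_exponent F / of_nat (card (Aut F))"

lemma (in iso) half_exponent: "half_exponent G = half_exponent F"
proof -
  have "inj_on f (strong F)"
    using inj wf by (auto simp: wf_forest_def intro: inj_on_subset)
  then have "half_exponent G = (\<Sum>v\<in>strong F. card (wout G (f v)))"
    by (simp add: half_exponent_def strong sum.reindex)
  also have "\<dots> = half_exponent F"
    unfolding half_exponent_def
    by (rule sum.cong) (use wf_forestD(7)[OF wf(1)] in \<open>auto simp: card_wout\<close>)
  finally show ?thesis .
qed

lemma (in iso) weight: "weight G = weight F"
  by (simp add: weight_def half_exponent card_Aut)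

lemma weight_nonzero:
  assumes "wf_forest F"
  shows "weight F \<noteq> 0"
proof -
  have "id \<in> Aut F"
    using forest_iso_id[of F] by (auto simp: Aut_def id_def permutes_def)
  then have "card (Aut F) \<noteq> 0"
    using finite_Aut[OF wf_forestD(1)[OF assms]] by auto
  then show ?thesis
    by (simp add: weight_def)
qed

definition term_A :: "nat forest \<Rightarrow> gseries" where
  "term_A F = gconst (1 / of_nat (card (Aut F))) * gvar 0 ^ tr F *
     (\<Prod>v\<in>verts F - leaves F. gvar (level F v) ^ (card (out F v) - 1))"

definition term_B :: "nat forest \<Rightarrow> gseries" where
  "term_B T = gconst (1 / of_nat (card (Aut T))) *
     (\<Prod>v\<in>strong T. (gconst (1 / 2) * gvar (level T v)) ^ card (wout T v)) *
     (\<Prod>v\<in>weak_nonleaves T. gvar (level T v) ^ (card (out T v) - 1))"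

text \<open>Levels start at 1, so index 0 is free for \<open>g_0\<close>, which counts the trees.
  Shifting turns it into \<open>g_1\<close>, the variable of the root in a graft.\<close>

definition full_mset :: "'a forest \<Rightarrow> nat multiset" where
  "full_mset F = replicate_mset (tr F) 0 + level_mset F"

lemma term_A_eq:
  assumes "wf_forest F" "strong F = {}"
  shows "term_A F = gmon (weight F) (full_mset F)"
proof -
  have "(\<Prod>v\<in>verts F - leaves F. gvar (level F v) ^ (card (out F v) - 1)) = gmon 1 (level_mset F)"
    using wf_forestD(1)[OF assms(1)] assms(2)
    by (simp add: gvar_power_gmon gmon_prod level_mset_def excess_def)
  then show ?thesis
    by (simp add: term_A_def gvar_power_gmon gconst_eq_gmon gmon_mult weight_def full_mset_def
        half_exponent_def assms(2))
qed

lemma term_B_eq: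
  assumes T: "levelled_forest T"
  shows "term_B T = gmon (weight T) (level_mset T)"
proof -
  note fin = wf_forestD(1,4)[OF levelled_imp_wf[OF T]]
  have nonleaves: "verts T - leaves T = strong T \<union> weak_nonleaves T"
    using T by (auto simp: weak_nonleaves_def levelled_forest_def)
  have split: "level_mset T =
      (\<Sum>v\<in>strong T. replicate_mset (excess T v) (level T v)) +
      (\<Sum>v\<in>weak_nonleaves T. replicate_mset (excess T v) (level T v))"
    unfolding level_mset_def nonleaves
    by (intro sum.union_disjoint) (use fin in \<open>auto simp: weak_nonleaves_def\<close>)
  have "(\<Prod>v\<in>strong T. (gconst (1 / 2) * gvar (level T v)) ^ card (wout T v)) =
      gmon ((1 / 2) ^ half_exponent T) (\<Sum>v\<in>strong T. replicate_mset (excess T v) (level T v))"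
    using fin by (simp add: half_gvar_power_gmon gmon_prod half_exponent_def power_sum excess_def)
  moreover have "(\<Prod>v\<in>weak_nonleaves T. gvar (level T v) ^ (card (out T v) - 1)) =
      gmon 1 (\<Sum>v\<in>weak_nonleaves T. replicate_mset (excess T v) (level T v))"
    using fin by (simp add: gvar_power_gmon gmon_prod weak_nonleaves_def excess_def)
  ultimately show ?thesis
    by (simp add: term_B_def gconst_eq_gmon gmon_mult weight_def split)
qed

text \<open>The new root contributes a half for each tree of \<open>W\<close>, which is the factor
  that the substitution of \<open>g_0 / 2\<close> produces in \<open>p_A\<close>.\<close>

lemma (in grafting) weight_T:
  "weight T = weight S * (weight W * (1 / 2) ^ tr W)"
  using sum_wout_T by (simp add: weight_def half_exponent_def card_Aut_T not_strong power_add)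

lemma (in grafting) level_mset_T_full:
  "level_mset T = image_mset Suc (level_mset S) + image_mset Suc (full_mset W)"
  by (simp add: level_mset_T full_mset_def)

lemma half_power_full_mset:
  assumes "wf_forest F"
  shows "(\<Prod>i\<in>#full_mset F. if i = 0 then 1 / 2 else 1 :: rat) = (1 / 2) ^ tr F"
proof -
  have "0 \<notin># level_mset F"
    using count_level_mset[OF wf_forestD(1)[OF assms], of 0]
    by (simp add: level_def not_in_iff)
  then have "image_mset (\<lambda>i. if i = 0 then 1 / 2 else 1 :: rat) (level_mset F) =
      image_mset (\<lambda>i. 1) (level_mset F)"
    by (intro image_mset_cong) (auto intro!: gr0I)
  then show ?thesis
    by (simp add: full_mset_def)
qed

section \<open>The empty forest and the single leaf\<close>

definition null_forest :: "nat forest" where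
  "null_forest = \<lparr>verts = {}, edges = {}, strong = {}\<rparr>"

definition dot_forest :: "nat forest" where
  "dot_forest = \<lparr>verts = {0}, edges = {}, strong = {}\<rparr>"

definition dot_forests :: "nat forest set" where
  "dot_forests = {F \<in> weak_forests. card (leaves F) = 1}"


lemma weak_forest_edgeless:
  assumes "edges F = {}" "finite (verts F)" "strong F = {}"
  shows "F \<in> weak_forests"
  using assms
  by (auto simp: weak_forests_def levelled_forest_def minimal_def trivial_tail_at_def leaves_def
      out_def acyclic_def)

lemma null_forest:
  "null_forest \<in> empty_forests" "level_mset null_forest = {#}" "full_mset null_forest = {#}"
  "weight null_forest = 1" "tr null_forest = 0" "wf_forest null_forest" "verts null_forest = {}"
proof -
  have "Aut null_forest = {id}"
    by (auto simp: Aut_def null_forest_def forest_iso_def)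
  then show "weight null_forest = 1"
    by (simp add: weight_def half_exponent_def null_forest_def)
  have "null_forest \<in> weak_forests"
    by (rule weak_forest_edgeless) (simp_all add: null_forest_def)
  then show "null_forest \<in> empty_forests"
    by (simp add: empty_forests_def null_forest_def leaves_def)
qed (simp_all add: level_mset_def full_mset_def tr_def roots_def null_forest_def wf_forest_def)

lemma dot_forest:
  "dot_forest \<in> dot_forests" "full_mset dot_forest = {#0#}" "weight dot_forest = 1"
  "wf_forest dot_forest"
proof -
  have leaves: "leaves dot_forest = {0}" and "roots dot_forest = {0}"
    by (auto simp: dot_forest_def leaves_def out_def roots_def)
  then show "full_mset dot_forest = {#0#}"
    by (simp add: full_mset_def level_mset_def tr_def) (simp add: dot_forest_def)
  have "Aut dot_forest = {id}"
    by (auto simp: Aut_def dot_forest_def forest_iso_def permutes_sing)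
  then show "weight dot_forest = 1"
    by (simp add: weight_def half_exponent_def dot_forest_def)
  have "dot_forest \<in> weak_forests"
    by (rule weak_forest_edgeless) (simp_all add: dot_forest_def)
  then show "dot_forest \<in> dot_forests"
    by (simp add: dot_forests_def leaves)
qed (simp add: dot_forest_def wf_forest_def)

lemma isomorphic_null_forest: "F \<in> empty_forests \<Longrightarrow> isomorphic F null_forest"
  using empty_forests_verts[of F] by (auto simp: isomorphic_def forest_iso_def null_forest_def)

lemma isomorphic_dot_forest:
  assumes "F \<in> dot_forests"
  shows "isomorphic F dot_forest"
proof -
  have F: "levelled_forest F" "minimal F" "strong F = {}" "card (leaves F) = 1"
    using assms by (auto simp: dot_forests_def weak_forests_def)
  obtain x where "verts F = {x}"
    using single_leaf(1)[OF F] by (rule card_1_singletonE)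
  then have "forest_iso (\<lambda>_. 0) F dot_forest"
    using single_leaf(2)[OF F] F(3) by (simp add: forest_iso_def dot_forest_def bij_betw_def)
  then show ?thesis
    by (auto simp: isomorphic_def)
qed

lemma weak_forests_eq: "weak_forests = forests_A \<union> dot_forests \<union> empty_forests"
proof -
  have "n \<ge> 2 \<or> n = 1 \<or> n = 0" for n :: nat
    by linarith
  then show ?thesis
    by (auto simp: forests_A_def dot_forests_def empty_forests_def weak_forests_def)
qed

lemma transversal_unique: "transversal A R \<Longrightarrow> F \<in> R \<Longrightarrow> G \<in> R \<Longrightarrow> isomorphic F G \<Longrightarrow> F = G"
  unfolding transversal_def using isomorphic_refl by (metis subsetD)

lemma sum_up_to_iso_transversal:
  assumes R: "transversal A R" and A: "\<And>F. F \<in> A \<Longrightarrow> wf_forest F"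
    and t: "\<And>F. F \<in> A \<Longrightarrow> t F = gmon (weight F) (\<mu> F)"
    and \<mu>: "\<And>F G f. iso f F G \<Longrightarrow> \<mu> G = \<mu> F"
  shows "sum_up_to_iso A t = mono_sum R weight \<mu>"
proof -
  have "sum_up_to_iso A t = formal_sum R (\<lambda>F. t F)"
  proof (rule sum_up_to_iso_reindex)
    show "F \<in> A" if "F \<in> R" for F
      using R that by (auto simp: transversal_def)
    show "\<exists>!G. G \<in> R \<and> isomorphic F G" if "F \<in> A" for F
      using R that by (simp add: transversal_def)
    fix F G assume FG: "F \<in> A" "G \<in> A" "isomorphic F G"
    obtain f where "iso f F G"
      using FG A by (metis isomorphic_imp_iso)
    then show "t F = t G"
      using t FG \<mu> iso.weight by metis
  qed
  also have "\<dots> = mono_sum R weight \<mu>"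
    by (rule formal_sum_eq_mono_sum)
      (use R t A weight_nonzero in \<open>auto simp: transversal_def dest!: subsetD\<close>)
  finally show ?thesis .
qed

lemma finite_image_Suc_fibres:
  assumes "\<And>m. finite {i \<in> I. \<mu> i = m}"
  shows "finite {i \<in> I. image_mset Suc (\<mu> i) = m}"
  \<comment> \<open>The predecessor map undoes \<open>Suc\<close>, so the preimage of
    \<open>m\<close> lies in a single fibre of \<open>\<mu>\<close>.\<close>
  by (rule finite_subset[of _ "{i \<in> I. \<mu> i = image_mset (\<lambda>n. n - 1) m}"])
    (use assms in \<open>auto simp: multiset.map_comp comp_def\<close>)

lemma finite_product_fibres:
  fixes \<mu> :: "'i \<Rightarrow> nat multiset"
  assumes "\<And>m. finite {i \<in> I. \<mu> i = m}" "\<And>m. finite {j \<in> J. \<nu> j = m}"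
  shows "finite {p \<in> I \<times> J. \<mu> (fst p) + \<nu> (snd p) = m}"
proof (rule finite_subset)
  let ?K = "{p :: nat multiset \<times> nat multiset. fst p + snd p = m}"
  show "{p \<in> I \<times> J. \<mu> (fst p) + \<nu> (snd p) = m} \<subseteq>
      (\<Union>p\<in>?K. {i \<in> I. \<mu> i = fst p} \<times> {j \<in> J. \<nu> j = snd p})"
    by auto
  show "finite \<dots>"
    using finite_mset_factorizations[of m] assms by (auto simp: case_prod_unfold)
qed

subsection \<open>The inductive formula\<close>

lemma shift_mono_sum: "shift (mono_sum I c \<mu>) = mono_sum I c (\<lambda>i. image_mset Suc (\<mu> i))"
  using gsubst_mono_sum[of "\<lambda>i. gvar (i + 1)" "\<lambda>_. 1" Suc I c \<mu>]
  by (simp add: shift_def gvar_eq_gmon)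

lemma half_mono_sum:
  "gsubst (\<lambda>i. if i = 0 then gconst (1 / 2) * gvar 0 else gvar i) (mono_sum I c \<mu>) =
    mono_sum I (\<lambda>i. c i * (\<Prod>j\<in>#\<mu> i. if j = 0 then 1 / 2 else 1)) \<mu>"
  by (subst gsubst_mono_sum[of _ "\<lambda>i. if i = 0 then 1 / 2 else 1" "\<lambda>i. i"])
    (auto simp: gconst_eq_gmon gvar_eq_gmon gmon_mult)

text \<open>Odd and even positive labels make the two parts disjoint and leave \<open>0\<close> for the root.\<close>

definition relabelled_graft :: "nat forest \<times> nat forest \<Rightarrow> nat forest" where
  "relabelled_graft p =
     graft 0 (relabel (\<lambda>n. 2 * n + 1) (fst p)) (relabel (\<lambda>n. 2 * n + 2) (snd p))"

lemma relabelled_graft: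
  assumes S: "S \<in> trees_B \<union> empty_forests" and W: "W \<in> weak_forests"
    and nonempty: "verts S \<union> verts W \<noteq> {}"
  defines "S' \<equiv> relabel (\<lambda>n. 2 * n + 1) S" and "W' \<equiv> relabel (\<lambda>n. 2 * n + 2) W"
  shows "grafting 0 S' W'" "isomorphic S S'" "isomorphic W W'"
    "relabelled_graft (S, W) \<in> trees_B"
    "weight (relabelled_graft (S, W)) = weight S * (weight W * (1 / 2) ^ tr W)"
    "level_mset (relabelled_graft (S, W)) =
       image_mset Suc (level_mset S) + image_mset Suc (full_mset W)"
proof -
  have levelled: "levelled_forest S" "levelled_forest W"
    using S W by (auto simp: trees_B_def empty_forests_def weak_forests_def)
  have "iso (\<lambda>n. 2 * n + 1) S S'"
    unfolding S'_def
    by (rule iso_relabel[OF levelled_imp_wf[OF levelled(1)]]) (auto simp: inj_on_def)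
  then interpret S: iso "\<lambda>n. 2 * n + 1" S S' .
  have "iso (\<lambda>n. 2 * n + 2) W W'"
    unfolding W'_def
    by (rule iso_relabel[OF levelled_imp_wf[OF levelled(2)]]) (auto simp: inj_on_def)
  then interpret W: iso "\<lambda>n. 2 * n + 2" W W' .
  show "isomorphic S S'" "isomorphic W W'"
    using S.iso W.iso by (auto simp: isomorphic_def)
  have W': "W' \<in> weak_forests"
    using W W.levelled W.minimal W.strong by (auto simp: weak_forests_def)
  have S': "S' \<in> trees_B \<union> empty_forests"
    using S S.levelled S.minimal S.strong S.tr isomorphic_card_leaves[OF \<open>isomorphic S S'\<close> S.wf]
    by (auto simp: trees_B_def empty_forests_def weak_forests_def)
  show grafting: "grafting 0 S' W'"
  proof
    have "2 * m + 1 \<noteq> 2 * n + 2" for m n :: nat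
      by presburger
    then show "verts S' \<inter> verts W' = {}"
      by (auto simp: S.verts W.verts)
    show "verts S' \<union> verts W' \<noteq> {}"
      using nonempty by (auto simp: S.verts W.verts)
    show "roots S' \<subseteq> strong S'"
      using S' by (rule roots_subset_strong)
    show "oriented_forest S'" "oriented_forest W'"
      using levelled S.levelled W.levelled levelled_imp_oriented by blast+
  qed (use W' in \<open>auto simp: S.verts W.verts weak_forests_def\<close>)
  have eq: "relabelled_graft (S, W) = graft 0 S' W'"
    by (simp add: relabelled_graft_def S'_def W'_def)
  show "relabelled_graft (S, W) \<in> trees_B"
    unfolding eq by (rule graft_in_trees_B[OF grafting S' W'])
  interpret grafting 0 S' W' by fact
  show "weight (relabelled_graft (S, W)) = weight S * (weight W * (1 / 2) ^ tr W)"
    by (simp add: eq weight_T S.weight W.weight W.tr)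
  show "level_mset (relabelled_graft (S, W)) =
      image_mset Suc (level_mset S) + image_mset Suc (full_mset W)"
    by (simp add: eq level_mset_T_full S.level_mset W.level_mset W.tr full_mset_def)
qed

theorem theorem3p4:
  shows "Q_B = shift p_A_half + shift Q_B * (1 + shift p_A_half)"
proof -
  obtain RA RB where RA: "transversal forests_A RA" and RB: "transversal trees_B RB"
    using transversal_exists by metis
  define RW where "RW = insert null_forest (insert dot_forest RA)"
  define RS where "RS = insert null_forest RB"
  have wf: "wf_forest F" if "F \<in> weak_forests \<union> trees_B" for F
    using that levelled_imp_wf by (auto simp: weak_forests_def trees_B_def)
  have weak: "forests_A \<subseteq> weak_forests" "dot_forests \<subseteq> weak_forests" "empty_forests \<subseteq> weak_forests"
    using weak_forests_eq by auto
  \<comment> \<open>The number of leaves is an isomorphism invariant, which keeps the empty forest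
    and the single leaf apart from the other classes.\<close>
  have separated: "\<not> isomorphic F G"
    if "card (leaves F) \<noteq> card (leaves G)" "F \<in> weak_forests \<union> trees_B" "G \<in> weak_forests \<union> trees_B"
    for F G
    using that isomorphic_card_leaves wf by blast
  have "transversal (forests_A \<union> dot_forests) (insert dot_forest RA)"
  proof (rule transversal_insert[OF RA dot_forest(1) isomorphic_dot_forest])
    show "\<not> isomorphic F G" if "F \<in> forests_A" "G \<in> dot_forests" for F G
      using that weak by (intro separated) (auto simp: forests_A_def dot_forests_def)
  qed
  then have RW: "transversal weak_forests RW"
    unfolding weak_forests_eq RW_def
  proof (rule transversal_insert[OF _ null_forest(1) isomorphic_null_forest])
    show "\<not> isomorphic F G" if "F \<in> forests_A \<union> dot_forests" "G \<in> empty_forests" for F G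
      using that weak by (intro separated) (auto simp: forests_A_def dot_forests_def empty_forests_def)
  qed
  have RS: "transversal (trees_B \<union> empty_forests) RS"
    unfolding RS_def
  proof (rule transversal_insert[OF RB null_forest(1) isomorphic_null_forest])
    show "\<not> isomorphic F G" if "F \<in> trees_B" "G \<in> empty_forests" for F G
      using that weak by (intro separated) (auto simp: trees_B_def empty_forests_def)
  qed
  have RW_sub: "RW \<subseteq> weak_forests" and RS_sub: "RS \<subseteq> trees_B \<union> empty_forests"
    using RW RS by (auto simp: transversal_def)

  have fin_W: "finite {F \<in> RW. full_mset F = m}" for m
  proof (rule finite_subset)
    show "{F \<in> RW. full_mset F = m} \<subseteq> {F \<in> RW. tr F \<le> size m \<and> level_mset F \<subseteq># m}"
      by (auto simp: full_mset_def)
    show "finite {F \<in> RW. tr F \<le> size m \<and> level_mset F \<subseteq># m}"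
      using RW_sub transversal_unique[OF RW]
      by (intro finite_level_mset_fibre) (auto simp: weak_forests_def)
  qed
  have fin_S: "finite {F \<in> RS. level_mset F = m}" for m
  proof (rule finite_subset)
    have "tr F = 0" if "F \<in> empty_forests" for F
      using empty_forests_verts[OF that] by (simp add: tr_def roots_def)
    then show "{F \<in> RS. level_mset F = m} \<subseteq> {F \<in> RS. tr F \<le> 1 \<and> level_mset F \<subseteq># m}"
      using RS_sub by (force simp: trees_B_def)
    show "finite {F \<in> RS. tr F \<le> 1 \<and> level_mset F \<subseteq># m}"
      using RS_sub transversal_unique[OF RS]
      by (intro finite_level_mset_fibre) (auto simp: trees_B_def empty_forests_def weak_forests_def)
  qed
  have not_in: "dot_forest \<notin> RA" "null_forest \<notin> insert dot_forest RA" "null_forest \<notin> RB"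
    using RA RB dot_forest(1) null_forest(1)
    by (auto simp: transversal_def forests_A_def dot_forests_def trees_B_def empty_forests_def)
  have fin_A: "finite {F \<in> RA. full_mset F = m}"
    and fin_dot: "finite {F \<in> insert dot_forest RA. full_mset F = m}" for m
    using fin_W[of m] by (auto simp: RW_def elim: rev_finite_subset)
  have fin_B: "finite {F \<in> RB. level_mset F = m}" for m
    using fin_S[of m] by (auto simp: RS_def elim: rev_finite_subset)

  have full_mset_iso: "full_mset G = full_mset F" if "iso f F G" for F G :: "nat forest" and f
    by (simp add: full_mset_def iso.tr[OF that] iso.level_mset[OF that])
  have "p_A = gvar 0 + sum_up_to_iso forests_A term_A"
    unfolding p_A_def term_A_def by simp
  also have "sum_up_to_iso forests_A term_A = mono_sum RA weight full_mset"
    by (rule sum_up_to_iso_transversal[OF RA])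
      (use weak wf full_mset_iso in \<open>auto simp: forests_A_def intro!: term_A_eq\<close>)
  also have "gvar 0 + mono_sum RA weight full_mset = mono_sum (insert dot_forest RA) weight full_mset"
    using mono_sum_insert[OF fin_A not_in(1), of weight] dot_forest by (simp add: gvar_eq_gmon)
  finally have p_A: "p_A = mono_sum (insert dot_forest RA) weight full_mset" .
  let ?wW = "\<lambda>F. weight F * (1 / 2) ^ tr F" and ?mW = "\<lambda>F. image_mset Suc (full_mset F)"
  let ?mS = "\<lambda>F. image_mset Suc (level_mset F)"
  have half: "p_A_half = mono_sum (insert dot_forest RA) ?wW full_mset"
    unfolding p_A_half_def p_A half_mono_sum
    by (rule mono_sum_cong) (use RW_sub wf in \<open>auto simp: RW_def half_power_full_mset\<close>)
  have "1 + shift p_A_half = 1 + mono_sum (insert dot_forest RA) ?wW ?mW"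
    unfolding half shift_mono_sum by (rule refl)
  also have "\<dots> = mono_sum RW ?wW ?mW"
    unfolding RW_def using finite_image_Suc_fibres[OF fin_dot] not_in(2)
    by (subst (2) mono_sum_insert) (simp_all add: null_forest one_eq_gmon)
  finally have W: "1 + shift p_A_half = mono_sum RW ?wW ?mW" .

  have "Q_B = sum_up_to_iso trees_B term_B"
    unfolding Q_B_def term_B_def by simp
  also have "\<dots> = mono_sum RB weight level_mset"
    by (rule sum_up_to_iso_transversal[OF RB])
      (use wf iso.level_mset in \<open>auto simp: trees_B_def intro!: term_B_eq\<close>)
  finally have Q: "Q_B = mono_sum RB weight level_mset" .
  have "1 + shift Q_B = 1 + mono_sum RB weight ?mS"
    by (simp add: Q shift_mono_sum)
  also have "\<dots> = mono_sum RS weight ?mS"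
    unfolding RS_def using finite_image_Suc_fibres[OF fin_B] not_in(3)
    by (subst mono_sum_insert) (simp_all add: null_forest one_eq_gmon)
  finally have S: "1 + shift Q_B = mono_sum RS weight ?mS" .

  \<comment> \<open>The pair of empty forests is left out because grafting it would give a root
    without children, a strong leaf, which is forbidden.\<close>
  define K where "K = RS \<times> RW - {(null_forest, null_forest)}"
  let ?c = "\<lambda>p. weight (fst p) * ?wW (snd p)" and ?m = "\<lambda>p. ?mS (fst p) + ?mW (snd p)"
  have K: "S \<in> trees_B \<union> empty_forests" "W \<in> weak_forests" "verts S \<union> verts W \<noteq> {}"
    if "(S, W) \<in> K" for S W
  proof -
    show S: "S \<in> trees_B \<union> empty_forests" and W: "W \<in> weak_forests"
      using that RS_sub RW_sub by (auto simp: K_def)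
    show "verts S \<union> verts W \<noteq> {}"
    proof
      assume empty: "verts S \<union> verts W = {}"
      have "wf_forest S"
        using wf S weak by blast
      then have "strong S = {}"
        using empty by (auto simp: wf_forest_def)
      then have "S \<in> empty_forests" "W \<in> empty_forests"
        using S W empty by (auto simp: trees_B_def empty_forests_def leaves_def)
      then have "isomorphic S null_forest" "isomorphic W null_forest"
        by (simp_all add: isomorphic_null_forest)
      moreover have "S \<in> RS" "null_forest \<in> RS" "W \<in> RW" "null_forest \<in> RW"
        using that unfolding K_def RS_def RW_def by blast+
      ultimately have "S = null_forest" "W = null_forest"
        using transversal_unique[OF RS, of S] transversal_unique[OF RW, of W] by simp_all
      then show False
        using that by (simp add: K_def)
    qed
  qed
  \<comment> \<open>A strong tree splits as a graft, its parts have unique representatives, and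
    grafts are isomorphic exactly if their parts are. So the grafted pairs form a system of
    representatives of the strong trees.\<close>
  have "\<exists>!k. k \<in> K \<and> isomorphic T (relabelled_graft k)" if "T \<in> trees_B" for T
    using that
  proof (cases rule: trees_B_cases)
    case (1 r S W)
    obtain S' where S': "S' \<in> RS" "isomorphic S S'" "\<And>G. G \<in> RS \<Longrightarrow> isomorphic S G \<Longrightarrow> G = S'"
      using RS 1(3) unfolding transversal_def by blast
    obtain W' where W': "W' \<in> RW" "isomorphic W W'" "\<And>G. G \<in> RW \<Longrightarrow> isomorphic W G \<Longrightarrow> G = W'"
      using RW 1(4) unfolding transversal_def by blast
    have iff: "isomorphic T (relabelled_graft (G, H)) \<longleftrightarrow> isomorphic S G \<and> isomorphic W H"
      if "(G, H) \<in> K" for G H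
    proof -
      note * = relabelled_graft(1-3)[OF K[OF that]]
      show ?thesis
        unfolding 1(1) relabelled_graft_def fst_conv snd_conv graft_isomorphic_iff[OF 1(2) *(1)]
        using *(2,3) isomorphic_trans isomorphic_sym by blast
    qed
    have "(S', W') \<in> K"
    proof -
      have "verts S \<union> verts W \<noteq> {}"
        using 1(2) by (rule grafting.nonempty)
      then have "\<not> (isomorphic S null_forest \<and> isomorphic W null_forest)"
        by (auto simp: isomorphic_def forest_iso_def bij_betw_def null_forest(7))
      then show ?thesis
        using S'(1,2) W'(1,2) by (auto simp: K_def)
    qed
    moreover have "k = (S', W')" if "k \<in> K" "isomorphic T (relabelled_graft k)" for k
      using that iff S'(3) W'(3) by (cases k) (auto simp: K_def)
    ultimately show ?thesis
      using iff S'(2) W'(2) by blast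
  qed
  then have "Q_B = formal_sum K (\<lambda>k. term_B (relabelled_graft k))"
    unfolding \<open>Q_B = sum_up_to_iso trees_B term_B\<close>
  proof (rule sum_up_to_iso_reindex[rotated])
    fix F G assume FG: "F \<in> trees_B" "G \<in> trees_B" "isomorphic F G"
    obtain f where "iso f F G"
      using FG wf by (metis UnCI isomorphic_imp_iso)
    then show "term_B F = term_B G"
      using FG by (simp add: trees_B_def term_B_eq iso.weight iso.level_mset)
  qed (use relabelled_graft(4) K in auto)
  also have "\<dots> = mono_sum K ?c ?m"
  proof (rule formal_sum_eq_mono_sum)
    fix k assume k: "k \<in> K"
    obtain S W where SW: "k = (S, W)"
      by (cases k)
    note K' = K[OF k[unfolded SW]]
    show "term_B (relabelled_graft k) = gmon (?c k) (?m k)"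
      using relabelled_graft(4-6)[OF K'] by (simp add: SW term_B_eq trees_B_def)
    show "?c k \<noteq> 0"
      using K' weak weight_nonzero[OF wf, of S] weight_nonzero[OF wf, of W] by (auto simp: SW)
  qed
  finally have "1 + Q_B = 1 + mono_sum K ?c ?m"
    by simp
  also have "\<dots> = mono_sum (RS \<times> RW) ?c ?m"
  proof -
    note fin = finite_product_fibres[OF finite_image_Suc_fibres[OF fin_S] finite_image_Suc_fibres[OF fin_W]]
    have "finite {p \<in> K. ?m p = m}" for m
      by (rule finite_subset[OF _ fin[of m]]) (auto simp: K_def)
    then have "mono_sum (insert (null_forest, null_forest) K) ?c ?m = 1 + mono_sum K ?c ?m"
      by (subst mono_sum_insert) (simp_all add: K_def null_forest one_eq_gmon)
    moreover have "insert (null_forest, null_forest) K = RS \<times> RW"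
      by (auto simp: K_def RS_def RW_def)
    ultimately show ?thesis
      by simp
  qed
  also have "\<dots> = (1 + shift Q_B) * (1 + shift p_A_half)"
    unfolding S W
    by (rule mono_sum_mult[symmetric]) (rule finite_image_Suc_fibres fin_S fin_W)+
  \<comment> \<open>Expanding the product and cancelling the 1 on both sides gives the stated
    form.\<close>
  finally show ?thesis
    by (simp add: algebra_simps)
qed

end
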